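(* Let $\Bbbk$ be an algebraically closed field of characteristic zero. Let $\mathbf f\in\Bbbk[x,y]$ be a product $\prod_{i=1}^nl_i$ of distinct linear forms, where $l_i=a_ix+b_iy+c_i\notin\Bbbk$ ($a_i,b_i,c_i\in\Bbbk$) and $l_i\notin\Bbbk^\times l_j$ for $i\ne j$. Suppose that for each $i$ there are at least three $j$ such that $l_i$ and $l_j$ generate the algebra $\Bbbk[x,y]$. Then ${}^1\Gamma_0(K\{\mathbf f\})=\Bbbk[x,y]$, i.e. $\mathbf f$ is $1$-flabby. This holds in particular if $\mathbf f$ is a homogeneous polynomial of degree $n\ge4$ that is a product of distinct linear forms. As a consequence, $\mathrm{vht}_1(K\{\mathbf f\})=\mathrm{fht}(K\{\mathbf f\})=\deg\mathbf f$, and $K\{\mathbf f\}$ is height cohereditary.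
   Context: For $\mathbf f\in\Bbbk(x,y)$, $K\{\mathbf f\}$ denotes the rational function field $\Bbbk(x,y)$ equipped with the unique ($\Bbbk$-bilinear) Poisson bracket such that $\{x,y\}=\mathbf f$; explicitly $\{g,h\}=\left(\frac{\partial g}{\partial x}\frac{\partial h}{\partial y}-\frac{\partial g}{\partial y}\frac{\partial h}{\partial x}\right)\mathbf f$. Let $K$ be a Poisson field over $\Bbbk$ and $w\in\mathbb Z$. A $w$-valuation on $K$ is a map $\nu:K\to\mathbb Z\cup\{\infty\}$ such that for all $a,b\in K$: $\nu(a)=\infty$ iff $a=0$; $\nu(ab)=\nu(a)+\nu(b)$; $\nu(a+b)\ge\min(\nu(a),\nu(b))$; $\nu(a)=0$ for $a\in\Bbbk^\times$; and $\nu(\{a,b\})\ge\nu(a)+\nu(b)-w$. It is trivial if $\nu(a)=0$ for all $a\neq0$, and classical if $\nu(\{a,b\})>\nu(a)+\nu(b)-w$ for all nonzero $a,b$. Put $F_0^\nu(K)=\{a\in K\mid\nu(a)\ge0\}$, and for $n\in\mathbb Z$ let ${}^n\Gamma_0(K)=\{a\in K\mid\nu(a)\ge0\text{ for all nontrivial }n\text{-valuations }\nu\text{ on }K\}$ (which is $K$ if there are none). A polynomial $\mathbf g\in\Bbbk[x,y]$ is $d$-flabby ($d\ge 1$) if ${}^d\Gamma_0(K\{\mathbf g\})=\Bbbk[x,y]$. If the bracket on $K$ is nontrivial, the $n$-valuation height is $\mathrm{vht}_n(K)=2+\inf\{w\in\mathbb Z\mid \text{there is a non-classical }w\text{-valuation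 }\nu\text{ on }K\text{ with }F_0^\nu(K)\cap{}^n\Gamma_0(K)=\Bbbk\}$ (with $\inf\emptyset=+\infty$, and $-\infty$ allowed). For $K$ of the form $K\{\mathbf f\}$, the flag height $\mathrm{fht}(K)$ is the minimum of the total degrees $\deg\mathbf g$ over $\mathbf g\in\Bbbk[x,y]$ with $K\cong K\{\mathbf g\}$ as Poisson fields, and $\infty$ if no such $\mathbf g$ exists. Such a $K$ is height cohereditary if $\mathrm{fht}(K)\le\mathrm{fht}(K')$ for every Poisson field $K'$ of the form $K\{\mathbf g\}$, $\mathbf g\in\Bbbk(x,y)$, into which $K$ embeds as a Poisson subfield. *)

theory Defs
  imports
    "HOL-Computational_Algebra.Computational_Algebra"
    "HOL-Library.Extended"
    "HOL-Library.Extended_Real"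
begin

section \<open>The polynomial ring in two variables and its field of fractions\<close>

text \<open>
  The ring \<open>k[x, y]\<close> is \<open>(k[x])[y]\<close>: in the type \<open>'k poly poly\<close> the outer variable is \<open>y\<close>, the
  inner one is \<open>x\<close>, and the coefficient of \<open>x\<^sup>i y\<^sup>j\<close> in \<open>p\<close> is \<open>coeff (coeff p j) i\<close>. The field
  \<open>k(x, y)\<close> is the type \<open>'k poly poly fract\<close>, in which \<open>k[x, y]\<close> is \<open>range to_fract\<close>.
\<close>

definition cst :: "'k::field \<Rightarrow> 'k poly poly" where
  "cst c = [:[:c:]:]"

definition var_x :: "'k::field poly poly" where
  "var_x = [:[:0, 1:]:]"

definition var_y :: "'k::field poly poly" where
  "var_y = [:0, 1:]"

text \<open>The zero polynomial gets total degree 0.\<close>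

definition total_degree :: "'k::field poly poly \<Rightarrow> nat" where
  "total_degree p = (if p = 0 then 0 else Max {i + j |i j. coeff (coeff p j) i \<noteq> 0})"

definition homogeneous :: "nat \<Rightarrow> 'k::field poly poly \<Rightarrow> bool" where
  "homogeneous d p \<longleftrightarrow> (\<forall>i j. coeff (coeff p j) i \<noteq> 0 \<longrightarrow> i + j = d)"

inductive_set alg_generated :: "'k::field poly poly set \<Rightarrow> 'k poly poly set"
  for S :: "'k poly poly set" where
  scalars: "cst c \<in> alg_generated S"
| generators: "p \<in> S \<Longrightarrow> p \<in> alg_generated S"
| sums: "p \<in> alg_generated S \<Longrightarrow> q \<in> alg_generated S \<Longrightarrow> p + q \<in> alg_generated S"
| products: "p \<in> alg_generated S \<Longrightarrow> q \<in> alg_generated S \<Longrightarrow> p * q \<in> alg_generated S"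

definition poly_dx :: "'k::field poly poly \<Rightarrow> 'k poly poly" where
  "poly_dx = map_poly pderiv"

lemma coeff_poly_dx: "coeff (poly_dx p) n = pderiv (coeff p n)"
  by (simp add: poly_dx_def coeff_map_poly)

lemma poly_dx_add: "poly_dx (p + q) = poly_dx p + poly_dx q"
  by (rule poly_eqI) (simp add: coeff_poly_dx pderiv_add)

lemma pderiv_sum': "pderiv (sum f A) = (\<Sum>i\<in>A. pderiv (f i))" for f :: "_ \<Rightarrow> 'k::field poly"
  by (induction A rule: infinite_finite_induct) (simp_all add: pderiv_add)

lemma pderiv_mult': "pderiv (p * q) = pderiv p * q + p * pderiv q" for p q :: "'k::idom poly"
  by (simp add: pderiv_mult algebra_simps)

lemma poly_dx_mult: "poly_dx (p * q) = poly_dx p * q + p * poly_dx q"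
  by (rule poly_eqI)
    (simp add: coeff_poly_dx coeff_mult pderiv_sum' pderiv_mult' sum.distrib)

lemma quotient_rule_welldefined:
  fixes D :: "'r::idom \<Rightarrow> 'r"
  assumes D: "\<And>a b. D (a * b) = D a * b + a * D b"
    and nz: "b \<noteq> 0" "d \<noteq> 0" and eq: "a * d = c * b"
  shows "(D a * b - a * D b) * (d * d) = (D c * d - c * D d) * (b * b)"
proof -
  have "D a * d + a * D d = D c * b + c * D b"
    using eq D by metis
  then have 1: "D a * d = D c * b + c * D b - a * D d"
    by (simp add: eq_diff_eq)
  have "(D a * b - a * D b) * (d * d) = (D a * d) * (b * d) - (a * d) * (D b * d)"
    by (simp add: algebra_simps)
  also have "\<dots> = (D c * b + c * D b) * (b * d) - (a * d) * (D d * b) - (c * b) * (D b * d)"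
    unfolding 1 by (simp add: algebra_simps eq)
  also have "\<dots> = (D c * d - c * D d) * (b * b)"
    unfolding eq by (simp add: algebra_simps)
  finally show ?thesis .
qed

text \<open>
  The extension of a derivation to the field of fractions by the quotient rule; for a derivation the
  result does not depend on the representation of the fraction.
\<close>

definition fract_deriv :: "('r::idom \<Rightarrow> 'r) \<Rightarrow> 'r fract \<Rightarrow> 'r fract" where
  "fract_deriv D q =
    (THE r. \<exists>a b. b \<noteq> 0 \<and> q = Fract a b \<and> r = Fract (D a * b - a * D b) (b * b))"

definition d_dx :: "'k::field poly poly fract \<Rightarrow> 'k poly poly fract" where
  "d_dx = fract_deriv poly_dx"

definition d_dy :: "'k::field poly poly fract \<Rightarrow> 'k poly poly fract" where
  "d_dy = fract_deriv pderiv"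

lemma fract_deriv_Fract:
  fixes D :: "'r::idom \<Rightarrow> 'r"
  assumes "b \<noteq> 0" and "\<And>a b. D (a * b) = D a * b + a * D b"
  shows "fract_deriv D (Fract a b) = Fract (D a * b - a * D b) (b * b)"
  unfolding fract_deriv_def
proof (rule the_equality)
  fix r
  assume "\<exists>a' b'. b' \<noteq> 0 \<and> Fract a b = Fract a' b' \<and> r = Fract (D a' * b' - a' * D b') (b' * b')"
  then obtain a' b' where *: "b' \<noteq> 0" "a' * b = a * b'"
    "r = Fract (D a' * b' - a' * D b') (b' * b')"
    using assms(1) by (auto simp: eq_fract)
  then show "r = Fract (D a * b - a * D b) (b * b)"
    using quotient_rule_welldefined [of D b' b a' a] assms by (simp add: eq_fract)
qed (use assms in blast)

lemma d_dx_Fract: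
  "b \<noteq> 0 \<Longrightarrow> d_dx (Fract a b) = Fract (poly_dx a * b - a * poly_dx b) (b * b)"
  by (simp add: d_dx_def fract_deriv_Fract poly_dx_mult)

lemma d_dy_Fract:
  "b \<noteq> 0 \<Longrightarrow> d_dy (Fract a b) = Fract (pderiv a * b - a * pderiv b) (b * b)"
  by (simp add: d_dy_def fract_deriv_Fract pderiv_mult')


section \<open>Poisson fields\<close>

text \<open>A field \<open>'f\<close> with its structure map from the ground field \<open>'k\<close> and a bracket.\<close>

record ('k, 'f) poisson =
  scalar :: "'k \<Rightarrow> 'f"
  bracket :: "'f \<Rightarrow> 'f \<Rightarrow> 'f"

definition poisson_field :: "('k::field, 'f::field) poisson \<Rightarrow> bool" where
  "poisson_field K \<longleftrightarrow>
    scalar K 1 = 1 \<and>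
    (\<forall>c d. scalar K (c + d) = scalar K c + scalar K d) \<and>
    (\<forall>c d. scalar K (c * d) = scalar K c * scalar K d) \<and>
    (\<forall>a b c. bracket K (a + b) c = bracket K a c + bracket K b c) \<and>
    (\<forall>s a b. bracket K (scalar K s * a) b = scalar K s * bracket K a b) \<and>
    (\<forall>a. bracket K a a = 0) \<and>
    (\<forall>a b. bracket K a b = - bracket K b a) \<and>
    (\<forall>a b c. bracket K a (bracket K b c) + bracket K b (bracket K c a)
      + bracket K c (bracket K a b) = 0) \<and>
    (\<forall>a b c. bracket K a (b * c) = bracket K a b * c + b * bracket K a c)"

text \<open>\<open>Kxy f\<close> is the field \<open>k(x, y)\<close> with the Poisson bracket given by \<open>{x, y} = f\<close>.\<close>

definition Kxy :: "'k::field poly poly fract \<Rightarrow> ('k, 'k poly poly fract) poisson" where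
  "Kxy f = \<lparr>scalar = (\<lambda>c. to_fract (cst c)),
          bracket = (\<lambda>g h. (d_dx g * d_dy h - d_dy g * d_dx h) * f)\<rparr>"

text \<open>Homomorphisms of Poisson fields over \<open>k\<close>; like all field homomorphisms they are injective.\<close>

definition poisson_hom ::
  "('k::field, 'f::field) poisson \<Rightarrow> ('k, 'g::field) poisson \<Rightarrow> ('f \<Rightarrow> 'g) \<Rightarrow> bool" where
  "poisson_hom K L \<phi> \<longleftrightarrow>
    (\<forall>c. \<phi> (scalar K c) = scalar L c) \<and>
    \<phi> 1 = 1 \<and>
    (\<forall>a b. \<phi> (a + b) = \<phi> a + \<phi> b) \<and>
    (\<forall>a b. \<phi> (a * b) = \<phi> a * \<phi> b) \<and>
    (\<forall>a b. \<phi> (bracket K a b) = bracket L (\<phi> a) (\<phi> b))"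

definition poisson_embeds ::
  "('k::field, 'f::field) poisson \<Rightarrow> ('k, 'g::field) poisson \<Rightarrow> bool" where
  "poisson_embeds K L \<longleftrightarrow> (\<exists>\<phi>. poisson_hom K L \<phi>)"

definition poisson_iso ::
  "('k::field, 'f::field) poisson \<Rightarrow> ('k, 'g::field) poisson \<Rightarrow> bool" where
  "poisson_iso K L \<longleftrightarrow> (\<exists>\<phi>. poisson_hom K L \<phi> \<and> bij \<phi>)"


section \<open>Valuations\<close>

text \<open>
  Valuations take values in \<open>\<int> \<union> {\<infinity>}\<close>, encoded as \<open>int extended\<close> without its least element \<open>Minf\<close>;
  \<open>Pinf\<close> is \<open>\<infinity>\<close>.
\<close>

definition w_valuation ::
  "('k::field, 'f::field) poisson \<Rightarrow> int \<Rightarrow> ('f \<Rightarrow> int extended) \<Rightarrow> bool" where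
  "w_valuation K w \<nu> \<longleftrightarrow>
    (\<forall>a. \<nu> a \<noteq> Minf) \<and>
    (\<forall>a. \<nu> a = Pinf \<longleftrightarrow> a = 0) \<and>
    (\<forall>a b. \<nu> (a * b) = \<nu> a + \<nu> b) \<and>
    (\<forall>a b. \<nu> (a + b) \<ge> min (\<nu> a) (\<nu> b)) \<and>
    (\<forall>c. c \<noteq> 0 \<longrightarrow> \<nu> (scalar K c) = 0) \<and>
    (\<forall>a b. \<nu> (bracket K a b) \<ge> \<nu> a + \<nu> b - Fin w)"

definition trivial_valuation :: "('f::field \<Rightarrow> int extended) \<Rightarrow> bool" where
  "trivial_valuation \<nu> \<longleftrightarrow> (\<forall>a. a \<noteq> 0 \<longrightarrow> \<nu> a = 0)"

definition classical ::
  "('k::field, 'f::field) poisson \<Rightarrow> int \<Rightarrow> ('f \<Rightarrow> int extended) \<Rightarrow> bool" where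
  "classical K w \<nu> \<longleftrightarrow>
    (\<forall>a b. a \<noteq> 0 \<longrightarrow> b \<noteq> 0 \<longrightarrow> \<nu> (bracket K a b) > \<nu> a + \<nu> b - Fin w)"

definition F0 :: "('f::field \<Rightarrow> int extended) \<Rightarrow> 'f set" where
  "F0 \<nu> = {a. \<nu> a \<ge> 0}"

definition Gamma0 :: "int \<Rightarrow> ('k::field, 'f::field) poisson \<Rightarrow> 'f set" where
  "Gamma0 n K = {a. \<forall>\<nu>. w_valuation K n \<nu> \<and> \<not> trivial_valuation \<nu> \<longrightarrow> \<nu> a \<ge> 0}"

definition flabby :: "int \<Rightarrow> 'k::field poly poly \<Rightarrow> bool" where
  "flabby d g \<longleftrightarrow> d \<ge> 1 \<and> Gamma0 d (Kxy (to_fract g)) = range to_fract"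


section \<open>Heights\<close>

text \<open>Only meant for Poisson fields with nontrivial bracket.\<close>

definition vht :: "int \<Rightarrow> ('k::field, 'f::field) poisson \<Rightarrow> ereal" where
  "vht n K = 2 + (INF w \<in> {w. \<exists>\<nu>. w_valuation K w \<nu> \<and> \<not> classical K w \<nu> \<and>
                               F0 \<nu> \<inter> Gamma0 n K = range (scalar K)}. ereal (real_of_int w))"

text \<open>
  The infimum in \<^typ>\<open>enat\<close> of a nonempty set is its minimum, and that of the empty set is \<open>\<infinity>\<close>.
\<close>

definition fht :: "('k::field, 'f::field) poisson \<Rightarrow> enat" where
  "fht L = (INF g \<in> {g. poisson_iso L (Kxy (to_fract g))}. enat (total_degree g))"

definition height_cohereditary :: "('k::field, 'f::field) poisson \<Rightarrow> bool" where
  "height_cohereditary L \<longleftrightarrow> (\<forall>g. poisson_embeds L (Kxy g) \<longrightarrow> fht L \<le> fht (Kxy g))"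


section \<open>\<open>Kxy f\<close> is a Poisson field\<close>

lemma poly_dx_0 [simp]: "poly_dx 0 = 0" and poly_dx_1 [simp]: "poly_dx 1 = 0"
  by (simp_all add: poly_dx_def map_poly_1)

lemma d_dx_to_fract [simp]: "d_dx (to_fract p) = to_fract (poly_dx p)"
  by (simp add: to_fract_def d_dx_Fract)

lemma d_dy_to_fract [simp]: "d_dy (to_fract p) = to_fract (pderiv p)"
  by (simp add: to_fract_def d_dy_Fract)

lemma d_dx_0 [simp]: "d_dx 0 = 0" and d_dy_0 [simp]: "d_dy 0 = 0"
  using d_dx_to_fract [of 0] d_dy_to_fract [of 0] by simp_all

lemma d_dx_add: "d_dx (g + h) = d_dx g + d_dx h"
  by (cases g; cases h)
    (simp add: d_dx_Fract poly_dx_add poly_dx_mult eq_fract algebra_simps)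

lemma d_dy_add: "d_dy (g + h) = d_dy g + d_dy h"
  by (cases g; cases h)
    (simp add: d_dy_Fract pderiv_add pderiv_mult eq_fract algebra_simps)

lemma d_dx_mult: "d_dx (g * h) = d_dx g * h + g * d_dx h"
  by (cases g; cases h)
    (simp add: d_dx_Fract poly_dx_mult eq_fract algebra_simps)

lemma d_dy_mult: "d_dy (g * h) = d_dy g * h + g * d_dy h"
  by (cases g; cases h)
    (simp add: d_dy_Fract pderiv_mult eq_fract algebra_simps)

lemma d_dx_minus: "d_dx (- g) = - d_dx g"
proof -
  have "d_dx g + d_dx (- g) = 0"
    using d_dx_add [of g "- g"] by simp
  then show ?thesis
    by (simp add: add_eq_0_iff)
qed

lemma d_dy_minus: "d_dy (- g) = - d_dy g"
proof -
  have "d_dy g + d_dy (- g) = 0"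
    using d_dy_add [of g "- g"] by simp
  then show ?thesis
    by (simp add: add_eq_0_iff)
qed

lemma d_dx_diff: "d_dx (g - h) = d_dx g - d_dx h"
  using d_dx_add [of g "- h"] by (simp add: d_dx_minus)

lemma d_dy_diff: "d_dy (g - h) = d_dy g - d_dy h"
  using d_dy_add [of g "- h"] by (simp add: d_dy_minus)

lemma poly_dx_pderiv: "poly_dx (pderiv p) = pderiv (poly_dx p)"
proof (rule poly_eqI)
  fix n
  have *: "pderiv (of_nat m * q) = of_nat m * pderiv q" for m and q :: "'a poly"
    by (simp add: pderiv_mult)
  show "coeff (poly_dx (pderiv p)) n = coeff (pderiv (poly_dx p)) n"
    by (simp only: coeff_poly_dx coeff_pderiv *)
qed

lemma d_dx_d_dy: "d_dx (d_dy g) = d_dy (d_dx g)"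
proof (cases g)
  case (Fract a b)
  define c where "c = to_fract b"
  have c: "c \<noteq> 0" using Fract by (simp add: c_def)
  have gc: "g * c = to_fract a"
    using Fract by (simp add: c_def Fract_conv_to_fract)
  have "d_dx (d_dy (g * c)) = d_dy (d_dx (g * c))"
    unfolding gc by (simp add: poly_dx_pderiv)
  moreover have "d_dx (d_dy c) = d_dy (d_dx c)"
    by (simp add: c_def poly_dx_pderiv)
  ultimately have "d_dx (d_dy g) * c = d_dy (d_dx g) * c"
    by (simp add: d_dx_mult d_dy_mult d_dx_add d_dy_add algebra_simps)
  with c show ?thesis by simp
qed

lemma bracket_Kxy: "bracket (Kxy f) g h = (d_dx g * d_dy h - d_dy g * d_dx h) * f"
  by (simp add: Kxy_def)

lemma bracket_Kxy_vars: "bracket (Kxy f) (to_fract var_x) (to_fract var_y) = f"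
  by (simp add: bracket_Kxy poly_dx_def var_x_def var_y_def map_poly_pCons pderiv_pCons
      flip: one_pCons)

lemma poisson_field_Kxy: "poisson_field (Kxy f)"
proof -
  have s: "d_dx (to_fract (cst c)) = 0" "d_dy (to_fract (cst c)) = 0" for c :: 'a
    by (simp_all add: cst_def poly_dx_def map_poly_pCons)
  have one: "cst 1 = (1 :: 'a poly poly)"
    and add: "cst (c + d) = cst c + cst d"
    and mult: "cst (c * d) = cst c * cst d" for c d :: 'a
    by (simp_all add: cst_def flip: one_pCons)
  have scal: "scalar (Kxy f) = (\<lambda>c. to_fract (cst c))"
    by (simp add: Kxy_def)
  show ?thesis
    unfolding poisson_field_def bracket_Kxy scal
    by (intro conjI allI)
      (simp_all add: s d_dx_mult d_dy_mult d_dx_add d_dy_add d_dx_diff d_dy_diff d_dx_d_dy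
        algebra_simps del: d_dx_to_fract d_dy_to_fract, simp_all add: one add mult)
qed

end

(*
  The two inclusions for Gamma0: a fraction that is not a polynomial is negative at the p-adic
  valuation of a prime p of its denominator, and the p-adic valuation is a 1-valuation because
  differentiation lowers the order at p by at most one. Conversely, let v be a 1-valuation with
  d = min (v x) (v y) < 0, and choose i with v (l_i) maximal. The lines transversal to l_i all have
  value d, and the lines parallel to l_i have value at most 0. For a transversal line l_j, the
  inequality v {l_i, l_j} >= v (l_i) + v (l_j) - 1 says that the values of the remaining lines add up
  to at least -1, but two of them are transversal to l_i and contribute 2 d.

  The heights: minus the total degree is a (deg f - 2)-valuation. If v is any w-valuation that is
  nonnegative only at constants among the polynomials, then all lines have negative values, and the
  same inequality for two transversal lines gives w >= n - 2. A homomorphism of K{f} into K{h} with h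
  a polynomial maps Gamma0 into Gamma0, hence polynomials to polynomials, so that the degree valuation
  of K{h} pulls back to such a v, and deg h >= n.
*)
theory Submission
  imports Defs "HOL-Computational_Algebra.Field_as_Ring"
begin

text \<open>
  The library shows that bivariate polynomials form a factorial ring only over coefficient fields of
  class \<open>field_gcd\<close>. This copy of an arbitrary field belongs to that class.
\<close>

datatype (plugins only: size) 'a gcd_field = Gcd_Field (field_elem: 'a)

lemma gcd_field_eq_iff: "x = y \<longleftrightarrow> field_elem x = field_elem y"
  by (auto intro: gcd_field.expand)

instantiation gcd_field :: (field) field
begin
definition "0 = Gcd_Field 0"
definition "1 = Gcd_Field 1"
definition "x + y = Gcd_Field (field_elem x + field_elem y)"
definition "x - y = Gcd_Field (field_elem x - field_elem y)"
definition "- x = Gcd_Field (- field_elem x)"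
definition "x * y = Gcd_Field (field_elem x * field_elem y)"
definition "inverse x = Gcd_Field (inverse (field_elem x))"
definition "x div y = Gcd_Field (field_elem x / field_elem y)"
instance
  by standard
    (simp_all add: zero_gcd_field_def one_gcd_field_def plus_gcd_field_def minus_gcd_field_def
      uminus_gcd_field_def times_gcd_field_def inverse_gcd_field_def divide_gcd_field_def
      gcd_field_eq_iff algebra_simps divide_inverse)
end

instantiation gcd_field ::
  (field) "{unique_euclidean_ring, normalization_euclidean_semiring, normalization_semidom_multiplicative}"
begin

definition [simp]: "normalize_gcd_field = (normalize_field :: 'a gcd_field \<Rightarrow> _)"
definition [simp]: "unit_factor_gcd_field = (unit_factor_field :: 'a gcd_field \<Rightarrow> _)"
definition [simp]: "modulo_gcd_field = (mod_field :: 'a gcd_field \<Rightarrow> _)"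
definition [simp]: "euclidean_size_gcd_field = (euclidean_size_field :: 'a gcd_field \<Rightarrow> _)"
definition [simp]: "division_segment (x :: 'a gcd_field) = 1"

instance
  by standard
    (simp_all add: dvd_field_iff field_split_simps split: if_splits)

end

instantiation gcd_field :: (field) euclidean_ring_gcd
begin

definition gcd_gcd_field :: "'a gcd_field \<Rightarrow> 'a gcd_field \<Rightarrow> 'a gcd_field" where
  "gcd_gcd_field = Euclidean_Algorithm.gcd"
definition lcm_gcd_field :: "'a gcd_field \<Rightarrow> 'a gcd_field \<Rightarrow> 'a gcd_field" where
  "lcm_gcd_field = Euclidean_Algorithm.lcm"
definition Gcd_gcd_field :: "'a gcd_field set \<Rightarrow> 'a gcd_field" where
  "Gcd_gcd_field = Euclidean_Algorithm.Gcd"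
definition Lcm_gcd_field :: "'a gcd_field set \<Rightarrow> 'a gcd_field" where
  "Lcm_gcd_field = Euclidean_Algorithm.Lcm"

instance
  by standard
    (simp_all add: gcd_gcd_field_def lcm_gcd_field_def Gcd_gcd_field_def Lcm_gcd_field_def)

end

instance gcd_field :: (field) field_gcd ..

section \<open>Transport of bivariate polynomials to the copied coefficient field\<close>

lemma map_poly_hom_add:
  assumes "h 0 = 0" "\<And>a b. h (a + b) = h a + h b"
  shows "map_poly h (p + q) = map_poly h p + map_poly h q"
  by (rule poly_eqI) (simp add: coeff_map_poly assms)

lemma map_poly_hom_mult:
  assumes "h 0 = 0" "\<And>a b. h (a + b) = h a + h b" "\<And>a b. h (a * b) = h a * h b"
  shows "map_poly h (p * q) = map_poly h p * map_poly h q"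
proof (rule poly_eqI)
  fix n
  have sum: "h (\<Sum>i\<in>A. g i) = (\<Sum>i\<in>A. h (g i))" for g and A :: "nat set"
    by (induction A rule: infinite_finite_induct) (simp_all add: assms)
  show "coeff (map_poly h (p * q)) n = coeff (map_poly h p * map_poly h q) n"
    by (simp add: coeff_map_poly assms coeff_mult sum)
qed

lemma bij_map_poly:
  assumes "bij h" "h 0 = 0"
  shows "bij (map_poly h)"
proof (rule o_bij)
  have h: "inv h 0 = 0" "inv h \<circ> h = id" "h \<circ> inv h = id"
    using assms by (simp_all add: bij_def inv_f_eq surj_iff)
  show "map_poly (inv h) \<circ> map_poly h = id" "map_poly h \<circ> map_poly (inv h) = id"
    using h assms by (auto simp: fun_eq_iff poly_eq_iff coeff_map_poly)
qed

text \<open>A ring isomorphism, applied coefficientwise, onto a ring with unique factorization and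
  multiplicities.\<close>

definition to_gcd :: "'k::field poly poly \<Rightarrow> 'k gcd_field poly poly" where
  "to_gcd = map_poly (map_poly Gcd_Field)"

lemma Gcd_Field_hom:
  "Gcd_Field 0 = 0" "Gcd_Field (a + b) = Gcd_Field a + Gcd_Field b"
  "Gcd_Field (a * b) = Gcd_Field a * Gcd_Field b"
  by (simp_all add: zero_gcd_field_def plus_gcd_field_def times_gcd_field_def)

lemma bij_to_gcd: "bij to_gcd"
  unfolding to_gcd_def
  by (intro bij_map_poly o_bij [of field_elem]) (auto simp: Gcd_Field_hom fun_eq_iff)

lemma to_gcd_add: "to_gcd (p + q) = to_gcd p + to_gcd q"
  and to_gcd_mult: "to_gcd (p * q) = to_gcd p * to_gcd q"
  unfolding to_gcd_def
  by (simp_all add: map_poly_hom_add map_poly_hom_mult Gcd_Field_hom)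

lemma to_gcd_0 [simp]: "to_gcd 0 = 0"
  by (simp add: to_gcd_def)

lemma to_gcd_eq_0_iff [simp]: "to_gcd p = 0 \<longleftrightarrow> p = 0"
  using inj_eq [OF bij_is_inj [OF bij_to_gcd], of p 0] by simp

lemma to_gcd_1 [simp]: "to_gcd 1 = 1"
  using to_gcd_mult [of 1 1] by simp

text \<open>Surjectivity pulls the cofactor back, and injectivity pulls back the equation.\<close>

lemma to_gcd_dvd_iff: "to_gcd p dvd to_gcd q \<longleftrightarrow> p dvd q"
proof
  assume "to_gcd p dvd to_gcd q"
  then obtain r where "to_gcd q = to_gcd p * r" by blast
  moreover obtain r' where "r = to_gcd r'"
    using bij_is_surj [OF bij_to_gcd] by blast
  ultimately have "to_gcd q = to_gcd (p * r')"
    by (simp add: to_gcd_mult)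
  then have "q = p * r'"
    by (rule injD [OF bij_is_inj [OF bij_to_gcd]])
  then show "p dvd q" by simp
qed (auto simp: to_gcd_mult)

lemma to_gcd_power: "to_gcd (p ^ n) = to_gcd p ^ n"
  by (induction n) (simp_all add: to_gcd_mult)

section \<open>Extending valuations from polynomials to fractions\<close>

text \<open>The Jacobian determinant, that is, the bracket with {x, y} = 1. The bracket of K{f} is
  \<open>f\<close> times it.\<close>

definition poly_bracket :: "'k::field poly poly \<Rightarrow> 'k poly poly \<Rightarrow> 'k poly poly" where
  "poly_bracket p q = poly_dx p * pderiv q - pderiv p * poly_dx q"

lemma poly_bracket_add_left: "poly_bracket (p + q) r = poly_bracket p r + poly_bracket q r"
  and poly_bracket_add_right: "poly_bracket r (p + q) = poly_bracket r p + poly_bracket r q"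
  and poly_bracket_mult_left: "poly_bracket (p * q) r = poly_bracket p r * q + p * poly_bracket q r"
  and poly_bracket_mult_right: "poly_bracket r (p * q) = poly_bracket r p * q + p * poly_bracket r q"
  by (simp_all add: poly_bracket_def poly_dx_add poly_dx_mult pderiv_add pderiv_mult' algebra_simps)

lemma poly_bracket_self [simp]: "poly_bracket p p = 0"
  by (simp add: poly_bracket_def algebra_simps)

lemma poly_bracket_cst [simp]: "poly_bracket (cst c) p = 0" "poly_bracket p (cst c) = 0"
  by (simp_all add: poly_bracket_def cst_def poly_dx_def map_poly_pCons)

lemma poly_bracket_one: "poly_bracket 1 p = 0" "poly_bracket p 1 = 0"
  by (simp_all add: poly_bracket_def)

lemma poly_bracket_swap: "poly_bracket p q = - poly_bracket q p"
  by (simp add: poly_bracket_def algebra_simps)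

lemma bracket_to_fract:
  "bracket (Kxy (to_fract f)) (to_fract p) (to_fract q) = to_fract (poly_bracket p q * f)"
  by (simp add: bracket_Kxy poly_bracket_def)

text \<open>The quotient rule in both arguments. The numerator is kept as a sum of four products,
  with signs inside the cofactors, so that each summand can be estimated separately.\<close>

lemma bracket_Fract:
  assumes "b \<noteq> 0" "d \<noteq> 0"
  shows "bracket (Kxy (to_fract f)) (Fract a b) (Fract c d) =
    Fract ((poly_bracket a c * f) * (b * d) + (poly_bracket a d * f) * - (b * c) +
      ((poly_bracket b c * f) * - (a * d) + (poly_bracket b d * f) * (a * c))) ((b * b) * (d * d))"
  using assms
  by (simp add: bracket_Kxy d_dx_Fract d_dy_Fract to_fract_def eq_fract poly_bracket_def)
    (simp add: algebra_simps)

text \<open>The usual extension v(a/b) = v(a) - v(b) to the field of fractions. The description is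
  unique once \<open>v\<close> is multiplicative.\<close>

definition fract_val :: "('r::idom \<Rightarrow> int) \<Rightarrow> 'r fract \<Rightarrow> int extended" where
  "fract_val v q = (if q = 0 then Pinf else
    Fin (THE k. \<exists>a b. a \<noteq> 0 \<and> b \<noteq> 0 \<and> q = Fract a b \<and> k = v a - v b))"

locale poly_valuation =
  fixes v :: "'k::field poly poly \<Rightarrow> int"
  assumes mult: "p \<noteq> 0 \<Longrightarrow> q \<noteq> 0 \<Longrightarrow> v (p * q) = v p + v q"
    and add: "p \<noteq> 0 \<Longrightarrow> q \<noteq> 0 \<Longrightarrow> p + q \<noteq> 0 \<Longrightarrow> min (v p) (v q) \<le> v (p + q)"
    and cst: "c \<noteq> 0 \<Longrightarrow> v (cst c) = 0"
begin

lemma val_one [simp]: "v 1 = 0"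
  using mult [of 1 1] by simp

lemma val_minus [simp]: "v (- p) = v p"
proof (cases "p = 0")
  case False
  have "v (- 1) = 0" using mult [of "- 1" "- 1"] by simp
  then show ?thesis using mult [of "- 1" p] False by simp
qed simp

text \<open>Gives the zero polynomial the value \<infinity>, which the integer-valued
  \<open>v\<close> cannot take; sums may then vanish without case distinctions.\<close>

definition at_least :: "int \<Rightarrow> 'k poly poly \<Rightarrow> bool" where
  "at_least k p \<longleftrightarrow> p \<noteq> 0 \<longrightarrow> k \<le> v p"

lemma at_least_add: "at_least k p \<Longrightarrow> at_least k q \<Longrightarrow> at_least k (p + q)"
  using add [of p q] by (cases "p = 0"; cases "q = 0") (auto simp: at_least_def)

lemma at_least_mult: "at_least k p \<Longrightarrow> at_least m q \<Longrightarrow> at_least (k + m) (p * q)"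
  by (auto simp: at_least_def mult)

text \<open>Two representations satisfy a b' = a' b, and multiplicativity turns this into equal
  differences of values.\<close>

lemma fract_val_Fract:
  assumes "a \<noteq> 0" "b \<noteq> 0"
  shows "fract_val v (Fract a b) = Fin (v a - v b)"
proof -
  have "(THE k. \<exists>a' b'. a' \<noteq> 0 \<and> b' \<noteq> 0 \<and> Fract a b = Fract a' b' \<and> k = v a' - v b') = v a - v b"
  proof (rule the_equality)
    fix k
    assume "\<exists>a' b'. a' \<noteq> 0 \<and> b' \<noteq> 0 \<and> Fract a b = Fract a' b' \<and> k = v a' - v b'"
    then obtain a' b' where k: "a' \<noteq> 0" "b' \<noteq> 0" "k = v a' - v b'" and "a * b' = a' * b"
      using assms by (auto simp: eq_fract)
    then have "v a + v b' = v a' + v b"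
      using assms mult by metis
    with k show "k = v a - v b" by simp
  qed (use assms in blast)
  then show ?thesis
    using assms by (simp add: fract_val_def Fract_conv_to_fract)
qed

lemma fract_val_0 [simp]: "fract_val v 0 = Pinf"
  by (simp add: fract_val_def)

lemma fract_val_to_fract: "p \<noteq> 0 \<Longrightarrow> fract_val v (to_fract p) = Fin (v p)"
  using fract_val_Fract [of p 1] by (simp add: to_fract_def)

lemma le_fract_val_Fract:
  assumes "b \<noteq> 0" "at_least (k + v b) a"
  shows "Fin k \<le> fract_val v (Fract a b)"
  using assms fract_val_Fract [of a b] by (cases "a = 0") (auto simp: at_least_def fract_collapse)

lemma Fract_nonzero_cases:
  fixes q :: "'k poly poly fract"
  obtains "q = 0" | a b where "q = Fract a b" "a \<noteq> 0" "b \<noteq> 0"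
  by (cases q) (metis fract_collapse(1))

text \<open>It suffices to check the bracket inequality on polynomials, because
  \<open>bracket_Fract\<close> reduces the general case to brackets of numerators and
  denominators.\<close>

lemma w_valuation_fract_val:
  assumes bracket: "\<And>p q. p \<noteq> 0 \<Longrightarrow> q \<noteq> 0 \<Longrightarrow> at_least (v p + v q - w) (poly_bracket p q * f)"
  shows "w_valuation (Kxy (to_fract f)) w (fract_val v)"
  unfolding w_valuation_def
proof (intro conjI allI impI)
  fix q r :: "'k poly poly fract"
  show "fract_val v q \<noteq> Minf" "fract_val v q = Pinf \<longleftrightarrow> q = 0"
    by (simp_all add: fract_val_def)
  show "fract_val v (q * r) = fract_val v q + fract_val v r"
    by (cases q rule: Fract_nonzero_cases; cases r rule: Fract_nonzero_cases)
      (simp_all add: fract_val_Fract mult)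
  show "min (fract_val v q) (fract_val v r) \<le> fract_val v (q + r)"
  proof (cases "q = 0 \<or> r = 0")
    case False
    then obtain a b c d where *: "q = Fract a b" "r = Fract c d" "a \<noteq> 0" "b \<noteq> 0" "c \<noteq> 0" "d \<noteq> 0"
      by (cases q rule: Fract_nonzero_cases; cases r rule: Fract_nonzero_cases) auto
    then have "at_least (min (v a - v b) (v c - v d) + v (b * d)) (a * d + c * b)"
      by (intro at_least_add) (auto simp: at_least_def mult)
    with * show ?thesis
      by (simp add: fract_val_Fract le_fract_val_Fract)
  qed auto
  show "fract_val v q + fract_val v r - Fin w \<le> fract_val v (bracket (Kxy (to_fract f)) q r)"
  proof (cases "q = 0 \<or> r = 0")
    case False
    then obtain a b c d where *: "q = Fract a b" "r = Fract c d" "a \<noteq> 0" "b \<noteq> 0" "c \<noteq> 0" "d \<noteq> 0"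
      by (cases q rule: Fract_nonzero_cases; cases r rule: Fract_nonzero_cases) auto
    \<comment> \<open>A common bound for the four summands: each is a bracket of two of
      \<open>a\<close>, \<open>b\<close>, \<open>c\<close>, \<open>d\<close> times \<open>f\<close>
      and the other two.\<close>
    define k where "k = v a + v b + v c + v d - w"
    have summand: "at_least k ((poly_bracket p q * f) * r)"
      if "p \<noteq> 0" "q \<noteq> 0" "r \<noteq> 0" "v p + v q + v r = v a + v b + v c + v d" for p q r
      using at_least_mult [OF bracket [of p q], of "v r" r] that
      by (simp add: k_def at_least_def algebra_simps)
    have "at_least k ((poly_bracket a c * f) * (b * d) + (poly_bracket a d * f) * - (b * c) +
      ((poly_bracket b c * f) * - (a * d) + (poly_bracket b d * f) * (a * c)))"
      by (intro at_least_add summand) (use * in \<open>simp_all add: mult\<close>)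
    moreover have "k = v a - v b + (v c - v d) - w + v (b * b * (d * d))"
      using * by (simp add: mult k_def)
    ultimately have "Fin (v a - v b + (v c - v d) - w) \<le> fract_val v (bracket (Kxy (to_fract f)) q r)"
      unfolding *(1,2) bracket_Fract [OF *(4,6)]
      by (intro le_fract_val_Fract) (use * in simp_all)
    with * show ?thesis
      by (simp add: fract_val_Fract)
  qed (auto simp: bracket_Kxy)
next
  fix c :: 'k
  assume "c \<noteq> 0"
  then show "fract_val v (scalar (Kxy (to_fract f)) c) = 0"
    using fract_val_to_fract [of "cst c"]
    by (simp add: Kxy_def cst zero_extended_def) (simp add: cst_def)
qed

end

section \<open>The valuation of a prime polynomial\<close>

lemma poly_valuation_multiplicity:
  assumes "prime_elem P"
  shows "poly_valuation (\<lambda>p. int (multiplicity P (to_gcd p)))"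
proof
  have unit: "\<not> is_unit P" using assms by auto
  fix p q :: "'a poly poly" and c :: 'a
  show "int (multiplicity P (to_gcd (p * q))) =
      int (multiplicity P (to_gcd p)) + int (multiplicity P (to_gcd q))" if "p \<noteq> 0" "q \<noteq> 0"
    using that assms by (simp add: to_gcd_mult prime_elem_multiplicity_mult_distrib)
  show "min (int (multiplicity P (to_gcd p))) (int (multiplicity P (to_gcd q)))
      \<le> int (multiplicity P (to_gcd (p + q)))" if "p + q \<noteq> 0"
  proof -
    let ?m = "min (multiplicity P (to_gcd p)) (multiplicity P (to_gcd q))"
    have "P ^ ?m dvd to_gcd (p + q)"
      unfolding to_gcd_add by (intro dvd_add multiplicity_dvd') simp_all
    then have "?m \<le> multiplicity P (to_gcd (p + q))"
      by (intro multiplicity_geI unit) (use that in simp_all)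
    then show ?thesis by simp
  qed
  show "int (multiplicity P (to_gcd (cst c))) = 0" if "c \<noteq> 0"
  proof -
    have "to_gcd (cst c) * to_gcd (cst (inverse c)) = 1"
      using that by (simp add: cst_def flip: to_gcd_mult one_pCons)
    then have "is_unit (to_gcd (cst c))" by (metis dvd_triv_left)
    then show ?thesis by (simp add: multiplicity_unit_right)
  qed
qed

text \<open>Write a = p^m u and b = p^n v and expand by the Leibniz rule. The term with {p^m, p^n}
  vanishes, and every other term differentiates at most one power of \<open>p\<close>, so only one
  factor \<open>p\<close> is lost although the bracket has two derivatives.\<close>

lemma power_dvd_poly_bracket:
  assumes "p ^ m dvd a" "p ^ n dvd b"
  shows "p ^ (m + n - 1) dvd poly_bracket a b"
proof -
  obtain u where a: "a = p ^ m * u" using assms(1) by (rule dvdE)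
  obtain v where b: "b = p ^ n * v" using assms(2) by (rule dvdE)
  have left: "p ^ (k - 1) dvd poly_bracket (p ^ k) r" for k r
  proof (induction k)
    case (Suc k)
    then show ?case
      by (cases k) (auto simp: poly_bracket_mult_left poly_bracket_one intro!: dvd_add)
  qed (simp add: poly_bracket_one)
  have right: "p ^ (k - 1) dvd poly_bracket r (p ^ k)" for k r
    using left [of k r] poly_bracket_swap [of r "p ^ k"] by simp
  have "poly_bracket (p ^ k) p = 0" for k
    by (induction k) (simp_all add: poly_bracket_mult_left poly_bracket_one)
  then have powers: "poly_bracket (p ^ m) (p ^ n) = 0"
    by (induction n) (simp_all add: poly_bracket_mult_right poly_bracket_one)
  have "p ^ (m + n - 1) dvd p ^ n * poly_bracket (p ^ m) v"
    using mult_dvd_mono [OF dvd_refl [of "p ^ n"] left [of m v]]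
    by (cases m) (simp_all add: poly_bracket_one ac_simps flip: power_add)
  moreover have "p ^ (m + n - 1) dvd p ^ m * poly_bracket u (p ^ n)"
    using mult_dvd_mono [OF dvd_refl [of "p ^ m"] right [of n u]]
    by (cases n) (simp_all add: poly_bracket_one ac_simps flip: power_add)
  moreover have "p ^ (m + n - 1) dvd p ^ m * p ^ n"
    by (simp add: le_imp_power_dvd flip: power_add)
  moreover have "poly_bracket a b = (p ^ n * poly_bracket (p ^ m) v) * u +
      (p ^ m * poly_bracket u (p ^ n)) * v + (p ^ m * p ^ n) * poly_bracket u v"
    unfolding a b
    by (simp add: poly_bracket_mult_left poly_bracket_mult_right powers algebra_simps)
  ultimately show ?thesis
    by (simp add: dvd_add dvd_mult2)
qed

text \<open>Stated for every polynomial \<open>f\<close>, so that it also applies to the target of a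
  homomorphism.\<close>

lemma Gamma0_subset_range_to_fract: "Gamma0 1 (Kxy (to_fract f)) \<subseteq> range to_fract"
proof
  fix q
  assume q: "q \<in> Gamma0 1 (Kxy (to_fract f))"
  obtain a b where ab: "q = Fract a b" "b \<noteq> 0" by (cases q)
  show "q \<in> range to_fract"
  proof (rule ccontr)
    assume notin: "q \<notin> range to_fract"
    have a: "a \<noteq> 0" using notin ab by (metis fract_collapse(1) rangeI to_fract_0)
    have "\<not> to_gcd b dvd to_gcd a"
      using ab notin by (auto simp: to_gcd_dvd_iff Fract_conv_to_fract)
    \<comment> \<open>By unique factorization, a failure of divisibility is visible at a single
      prime.\<close>
    then obtain P where P: "prime P" "multiplicity P (to_gcd a) < multiplicity P (to_gcd b)"
      using multiplicity_le_imp_dvd [of "to_gcd b" "to_gcd a"] ab(2)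
      by (meson not_le to_gcd_eq_0_iff)
    define v where "v = (\<lambda>p. int (multiplicity P (to_gcd p)))"
    interpret poly_valuation v
      unfolding v_def using P by (intro poly_valuation_multiplicity) simp
    \<comment> \<open>The estimate of brackets concerns the original ring, so the prime is pulled
      back.\<close>
    obtain p where p: "P = to_gcd p" using bij_is_surj [OF bij_to_gcd] by blast
    have pow: "p ^ k dvd r \<longleftrightarrow> int k \<le> v r" if "r \<noteq> 0" for k r
      using that P power_dvd_iff_le_multiplicity [of "to_gcd r" P k] to_gcd_dvd_iff [of "p ^ k" r]
      by (simp add: v_def p to_gcd_power)
    have nonneg: "0 \<le> v r" for r by (simp add: v_def)
    have "w_valuation (Kxy (to_fract f)) 1 (fract_val v)"
    proof (rule w_valuation_fract_val)
      fix r s :: "'a poly poly"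
      assume "r \<noteq> 0" "s \<noteq> 0"
      then have "p ^ (nat (v r) + nat (v s) - 1) dvd poly_bracket r s"
        by (intro power_dvd_poly_bracket) (auto simp: pow nonneg)
      then have "p ^ (nat (v r) + nat (v s) - 1) dvd poly_bracket r s * f"
        by (rule dvd_mult2)
      \<comment> \<open>If both orders are 0, the truncated exponent is 0 instead of -1; the bound
        -1 then holds because polynomials have nonnegative values.\<close>
      then show "at_least (v r + v s - 1) (poly_bracket r s * f)"
        using nonneg [of r] nonneg [of s] nonneg [of "poly_bracket r s * f"]
        by (auto simp: at_least_def pow)
    qed
    moreover have neg: "fract_val v q < 0"
    proof -
      have "v a < v b" using P by (simp add: v_def)
      then show ?thesis using ab a by (simp add: fract_val_Fract zero_extended_def)
    qed
    moreover have "\<not> trivial_valuation (fract_val v)"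
      using neg ab a by (metis less_irrefl notin rangeI to_fract_0 trivial_valuation_def)
    ultimately show False
      using q by (auto simp: Gamma0_def)
  qed
qed

section \<open>The degree valuation\<close>

text \<open>
  The ring endomorphism \<open>x \<mapsto> x y, y \<mapsto> y\<close> turns the total degree into the degree in \<open>y\<close>.
\<close>

definition shear_x :: "'k::field poly \<Rightarrow> 'k poly poly" where
  "shear_x q = poly (map_poly cst q) [:0, [:0, 1:]:]"

definition shear :: "'k::field poly poly \<Rightarrow> 'k poly poly" where
  "shear p = poly (map_poly shear_x p) var_y"

lemma cst_0 [simp]: "cst 0 = 0"
  and cst_1 [simp]: "cst 1 = 1"
  and cst_add: "cst (c + d) = cst c + cst d"
  and cst_mult: "cst (c * d) = cst c * cst d"
  and cst_eq_0_iff [simp]: "cst c = 0 \<longleftrightarrow> c = 0"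
  by (simp_all add: cst_def flip: one_pCons)

lemma shear_x_add: "shear_x (p + q) = shear_x p + shear_x q"
  and shear_x_mult: "shear_x (p * q) = shear_x p * shear_x q"
  by (simp_all add: shear_x_def map_poly_hom_add map_poly_hom_mult cst_add cst_mult)

lemma shear_x_0 [simp]: "shear_x 0 = 0"
  by (simp add: shear_x_def)

lemma shear_add: "shear (p + q) = shear p + shear q"
  and shear_mult: "shear (p * q) = shear p * shear q"
  by (simp_all add: shear_def map_poly_hom_add map_poly_hom_mult shear_x_add shear_x_mult)

text \<open>Substituting x y for x sends x^m to x^m y^m.\<close>

lemma coeff_shear_x: "coeff (shear_x q) m = monom (coeff q m) m"
proof (induction q arbitrary: m)
  case (pCons c q)
  have "shear_x (pCons c q) = cst c + pCons 0 (smult [:0, 1:] (shear_x q))"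
    using pCons.hyps by (simp add: shear_x_def map_poly_pCons)
  then show ?case
    by (cases m) (simp_all add: cst_def pCons.IH monom_0 monom_Suc)
qed simp

text \<open>The monomial x^i y^j goes to x^i y^(i + j), so distinct monomials stay distinct and no
  terms can cancel.\<close>

lemma coeff_shear:
  "coeff (coeff (shear p) m) i = (if i \<le> m then coeff (coeff p (m - i)) i else 0)"
proof (induction p arbitrary: m)
  case (pCons q p)
  have "shear (pCons q p) = shear_x q + pCons 0 (shear p)"
    using pCons.hyps by (simp add: shear_def map_poly_pCons var_y_def)
  then show ?case
    by (cases m) (auto simp: coeff_shear_x pCons.IH Suc_diff_le le_Suc_eq)
qed (simp add: shear_def)

lemma shear_eq_0_iff [simp]: "shear p = 0 \<longleftrightarrow> p = 0"
proof
  assume "shear p = 0"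
  then have "coeff (coeff p j) i = 0" for i j
    using coeff_shear [of p "i + j" i] by simp
  then show "p = 0" by (simp add: poly_eq_iff)
qed (simp add: shear_def)

lemma total_degree_0 [simp]: "total_degree 0 = 0"
  by (simp add: total_degree_def)

text \<open>The set of exponent sums is finite and, for a nonzero polynomial, nonempty, so that the
  maximum in the definition is meaningful.\<close>

lemma total_degree_le_iff:
  "total_degree p \<le> d \<longleftrightarrow> (\<forall>i j. coeff (coeff p j) i \<noteq> 0 \<longrightarrow> i + j \<le> d)"
proof (cases "p = 0")
  case False
  let ?S = "{i + j |i j. coeff (coeff p j) i \<noteq> 0}"
  have "?S \<subseteq> (\<lambda>(i, j). i + j) ` (SIGMA j:{..degree p}. {..degree (coeff p j)})"
  proof clarify
    fix i j
    assume "coeff (coeff p j) i \<noteq> 0"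
    then have "j \<le> degree p" "i \<le> degree (coeff p j)"
      by (auto intro!: le_degree)
    then show "i + j \<in> (\<lambda>(i, j). i + j) ` (SIGMA j:{..degree p}. {..degree (coeff p j)})"
      by (intro image_eqI [of _ _ "(j, i)"]) auto
  qed
  then have "finite ?S" by (rule finite_subset) auto
  moreover have "?S \<noteq> {}"
    using False by (auto simp: poly_eq_iff)
  ultimately show ?thesis
    using False by (auto simp: total_degree_def)
qed (simp add: total_degree_def)

lemma le_total_degree: "coeff (coeff p j) i \<noteq> 0 \<Longrightarrow> i + j \<le> total_degree p"
  using total_degree_le_iff [of p "total_degree p"] by blast

text \<open>The exponent of y after the substitution is the old i + j. Additivity of the total
  degree thereby follows from that of the degree in one variable over a domain.\<close>

lemma total_degree_eq_degree_shear: "total_degree p = degree (shear p)"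
proof -
  have "total_degree p \<le> d \<longleftrightarrow> degree (shear p) \<le> d" for d
  proof
    assume "total_degree p \<le> d"
    then show "degree (shear p) \<le> d"
      by (auto intro!: degree_le simp: total_degree_le_iff poly_eq_iff coeff_shear)
        (metis add_diff_inverse_nat leD not_le)
  next
    assume "degree (shear p) \<le> d"
    then have "coeff (shear p) m = 0" if "m > d" for m
      using that by (intro coeff_eq_0) simp
    then have "i + j \<le> d" if "coeff (coeff p j) i \<noteq> 0" for i j
      using that coeff_shear [of p "i + j" i] by (cases "i + j \<le> d") auto
    then show "total_degree p \<le> d"
      by (simp add: total_degree_le_iff)
  qed
  then show ?thesis by (metis order_antisym order_refl)
qed

lemma total_degree_mult:
  "p \<noteq> 0 \<Longrightarrow> q \<noteq> 0 \<Longrightarrow> total_degree (p * q) = total_degree p + total_degree q"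
  by (simp add: total_degree_eq_degree_shear shear_mult degree_mult_eq)

lemma total_degree_add_le: "total_degree (p + q) \<le> max (total_degree p) (total_degree q)"
  by (simp add: total_degree_eq_degree_shear shear_add degree_add_le_max)

lemma total_degree_minus: "total_degree (- p) = total_degree p"
  by (simp add: total_degree_def)

lemma total_degree_cst [simp]: "total_degree (cst c) = 0"
  using total_degree_le_iff [of "cst c" 0]
  by (auto simp: cst_def coeff_pCons split: nat.splits if_splits)

lemma total_degree_0_imp_cst:
  assumes "total_degree p = 0"
  shows "p \<in> range cst"
proof -
  have "coeff (coeff p j) i = 0" if "i + j \<noteq> 0" for i j
    using that total_degree_le_iff [of p 0] assms by auto
  then have "p = cst (coeff (coeff p 0) 0)"
    by (auto simp: cst_def poly_eq_iff coeff_pCons split: nat.splits)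
  then show ?thesis by blast
qed

lemma total_degree_poly_dx: "poly_dx p \<noteq> 0 \<Longrightarrow> total_degree (poly_dx p) + 1 \<le> total_degree p"
  and total_degree_pderiv: "pderiv p \<noteq> 0 \<Longrightarrow> total_degree (pderiv p) + 1 \<le> total_degree p"
proof -
  have dx: "i + j + 1 \<le> total_degree p" if "coeff (coeff (poly_dx p) j) i \<noteq> 0" for i j
    using that le_total_degree [of p j "Suc i"] by (auto simp: coeff_poly_dx coeff_pderiv)
  have dy: "i + j + 1 \<le> total_degree p" if "coeff (coeff (pderiv p) j) i \<noteq> 0" for i j
    using that le_total_degree [of p "Suc j" i] by (auto simp: coeff_pderiv of_nat_poly simp del: of_nat_Suc)
  show "total_degree (poly_dx p) + 1 \<le> total_degree p" if nz: "poly_dx p \<noteq> 0"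
  proof -
    obtain j i where "coeff (coeff (poly_dx p) j) i \<noteq> 0"
      using nz by (auto simp: poly_eq_iff)
    \<comment> \<open>Ensures that the subtraction of 1 below is not truncated.\<close>
    then have "1 \<le> total_degree p" using dx by fastforce
    moreover have "total_degree (poly_dx p) \<le> total_degree p - 1"
      unfolding total_degree_le_iff using dx by fastforce
    ultimately show ?thesis by simp
  qed
  show "total_degree (pderiv p) + 1 \<le> total_degree p" if nz: "pderiv p \<noteq> 0"
  proof -
    obtain j i where "coeff (coeff (pderiv p) j) i \<noteq> 0"
      using nz by (metis coeff_0 poly_eq_iff)
    then have "1 \<le> total_degree p" using dy by fastforce
    moreover have "total_degree (pderiv p) \<le> total_degree p - 1"
      unfolding total_degree_le_iff using dy by fastforce
    ultimately show ?thesis by simp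
  qed
qed

interpretation degree_valuation: poly_valuation "\<lambda>p. - int (total_degree p)"
proof
  fix p q :: "'a poly poly"
  show "min (- int (total_degree p)) (- int (total_degree q)) \<le> - int (total_degree (p + q))"
    using total_degree_add_le [of p q] by linarith
qed (simp_all add: total_degree_mult)

abbreviation neg_degree :: "'k::field poly poly fract \<Rightarrow> int extended" where
  "neg_degree \<equiv> fract_val (\<lambda>p. - int (total_degree p))"

text \<open>Each of the two derivatives in a bracket lowers the degree by at least one, and the
  factor \<open>f\<close> adds its own degree.\<close>

lemma w_valuation_neg_degree:
  "w_valuation (Kxy (to_fract f)) (int (total_degree f) - 2) neg_degree"
proof (rule degree_valuation.w_valuation_fract_val)
  fix p q :: "'a poly poly"
  let ?at_least = "degree_valuation.at_least"
  have dx: "?at_least (1 - int (total_degree r)) (poly_dx r)"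
    and dy: "?at_least (1 - int (total_degree r)) (pderiv r)" for r :: "'a poly poly"
    using total_degree_poly_dx [of r] total_degree_pderiv [of r]
    by (auto simp: degree_valuation.at_least_def)
  have f: "?at_least (- int (total_degree f)) f"
    by (simp add: degree_valuation.at_least_def)
  \<comment> \<open>The sign moves into the argument \<open>q\<close>, whose degree it preserves,
    since the estimates are available for sums.\<close>
  have "poly_bracket p q * f = poly_dx p * pderiv q * f + pderiv p * poly_dx (- q) * f"
    using poly_dx_add [of q "- q"] by (simp add: poly_bracket_def add_eq_0_iff algebra_simps)
  moreover have "?at_least ((1 - int (total_degree p)) + (1 - int (total_degree q))
      + - int (total_degree f)) (poly_dx p * pderiv q * f + pderiv p * poly_dx (- q) * f)"
    using dx [of "- q"]
    by (intro degree_valuation.at_least_add degree_valuation.at_least_mult dx dy f)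
      (simp add: total_degree_minus)
  ultimately show "?at_least (- int (total_degree p) + - int (total_degree q)
      - (int (total_degree f) - 2)) (poly_bracket p q * f)"
    by (simp add: algebra_simps)
qed

lemma F0_neg_degree: "F0 neg_degree \<inter> range to_fract \<subseteq> range (\<lambda>c. to_fract (cst c))"
proof clarify
  fix p :: "'a poly poly"
  assume "to_fract p \<in> F0 neg_degree"
  then have "total_degree p = 0"
    by (cases "p = 0") (auto simp: F0_def degree_valuation.fract_val_to_fract zero_extended_def)
  then show "to_fract p \<in> range (\<lambda>c. to_fract (cst c))"
    using total_degree_0_imp_cst by blast
qed

section \<open>Lines and valuations\<close>

text \<open>The restriction of a valuation to polynomials with plain integer values; for a valuation
  the default 0 occurs only at the zero polynomial.\<close>

definition val_int :: "('k::field poly poly fract \<Rightarrow> int extended) \<Rightarrow> 'k poly poly \<Rightarrow> int" where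
  "val_int \<nu> p = (case \<nu> (to_fract p) of Fin k \<Rightarrow> k | _ \<Rightarrow> 0)"

lemma w_valuation_val_int:
  fixes f :: "'k::field poly poly"
  assumes \<nu>: "w_valuation (Kxy (to_fract f)) w \<nu>"
  shows val_int_Fin: "\<And>p. p \<noteq> 0 \<Longrightarrow> \<nu> (to_fract p) = Fin (val_int \<nu> p)"
    and poly_valuation_val_int: "poly_valuation (val_int \<nu>)"
    and val_int_bracket: "\<And>p q. p \<noteq> 0 \<Longrightarrow> q \<noteq> 0 \<Longrightarrow>
      poly_valuation.at_least (val_int \<nu>) (val_int \<nu> p + val_int \<nu> q - w) (poly_bracket p q * f)"
proof -
  have ax: "\<nu> r \<noteq> Minf" "\<nu> r = Pinf \<longleftrightarrow> r = 0" "\<nu> (r * s) = \<nu> r + \<nu> s" "min (\<nu> r) (\<nu> s) \<le> \<nu> (r + s)"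
    "c \<noteq> 0 \<Longrightarrow> \<nu> (to_fract (cst c)) = 0"
    "\<nu> r + \<nu> s - Fin w \<le> \<nu> (bracket (Kxy (to_fract f)) r s)" for r s c
    using \<nu> by (auto simp: w_valuation_def Kxy_def)
  show Fin: "\<nu> (to_fract p) = Fin (val_int \<nu> p)" if "p \<noteq> 0" for p
    using ax(1,2) [of "to_fract p"] that by (cases "\<nu> (to_fract p)") (auto simp: val_int_def)
  interpret poly_valuation "val_int \<nu>"
  proof
    fix p q :: "'k poly poly" and c :: 'k
    show "val_int \<nu> (p * q) = val_int \<nu> p + val_int \<nu> q" if "p \<noteq> 0" "q \<noteq> 0"
      using ax(3) [of "to_fract p" "to_fract q"] that by (simp add: Fin flip: to_fract_mult)
    show "min (val_int \<nu> p) (val_int \<nu> q) \<le> val_int \<nu> (p + q)" if "p \<noteq> 0" "q \<noteq> 0" "p + q \<noteq> 0"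
      using ax(4) [of "to_fract p" "to_fract q"] that by (simp add: Fin flip: to_fract_add)
    show "val_int \<nu> (cst c) = 0" if "c \<noteq> 0"
      using ax(5) [OF that] that by (simp add: Fin zero_extended_def)
  qed
  show "poly_valuation (val_int \<nu>)" ..
  show "at_least (val_int \<nu> p + val_int \<nu> q - w) (poly_bracket p q * f)" if "p \<noteq> 0" "q \<noteq> 0" for p q
  proof -
    have "Fin (val_int \<nu> p + val_int \<nu> q - w) \<le> \<nu> (to_fract (poly_bracket p q * f))"
      using ax(6) [of "to_fract p" "to_fract q"]
      by (simp only: bracket_to_fract Fin [OF that(1)] Fin [OF that(2)]
          plus_extended.simps minus_extended_simps)
    then show ?thesis by (auto simp: at_least_def Fin simp del: to_fract_mult)
  qed
qed

context poly_valuation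
begin

lemma at_least_cst: "at_least 0 (cst c)"
  using cst [of c] by (auto simp: at_least_def)

lemma val_cst_mult: "c \<noteq> 0 \<Longrightarrow> v (cst c * p) = v p"
  using mult [of "cst c" p] by (cases "p = 0") (simp_all add: cst)

lemma at_least_cst_mult: "at_least k p \<Longrightarrow> at_least k (cst c * p)"
  using at_least_mult [OF at_least_cst [of c]] by fastforce

text \<open>Elements of nonnegative value form a ring containing the constants; with x and y it
  contains k[x, y]. The two inductions follow the Horner forms in y and in x.\<close>

lemma at_least_0:
  assumes "at_least 0 var_x" "at_least 0 var_y"
  shows "at_least 0 p"
proof (induction p)
  case (pCons q p)
  have q: "at_least 0 [:q:]"
  proof (induction q)
    case (pCons c q)
    have "[:pCons c q:] = cst c + var_x * [:q:]"
      by (simp add: cst_def var_x_def)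
    then show ?case
      using at_least_add [OF at_least_cst at_least_mult [OF assms(1) pCons.IH, simplified]] by simp
  qed (simp add: at_least_def)
  have "pCons q p = [:q:] + var_y * p"
    by (simp add: var_y_def)
  then show ?case
    using at_least_add [OF q at_least_mult [OF assms(2) pCons.IH, simplified]] by simp
qed (simp add: at_least_def)

lemma val_prod: "(\<And>i. i \<in> A \<Longrightarrow> g i \<noteq> 0) \<Longrightarrow> v (\<Prod>i\<in>A. g i) = (\<Sum>i\<in>A. v (g i))"
  by (induction A rule: infinite_finite_induct) (simp_all add: mult)

end

section \<open>Affine linear forms and their brackets\<close>

lemma cst_minus: "cst (- c) = - cst c"
  and cst_diff: "cst (c - d) = cst c - cst d"
  by (simp_all add: cst_def)

lemma total_degree_var [simp]:
  "total_degree (var_x :: 'a::field poly poly) = 1" "total_degree (var_y :: 'a poly poly) = 1"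
proof -
  have "coeff (coeff (var_x :: 'a poly poly) 0) 1 \<noteq> 0" "coeff (coeff (var_y :: 'a poly poly) 1) 0 \<noteq> 0"
    by (simp_all add: var_x_def var_y_def)
  then have "1 \<le> total_degree (var_x :: 'a poly poly)" "1 \<le> total_degree (var_y :: 'a poly poly)"
    using le_total_degree by fastforce+
  moreover have "total_degree (var_x :: 'a poly poly) \<le> 1" "total_degree (var_y :: 'a poly poly) \<le> 1"
    by (auto simp: total_degree_le_iff var_x_def var_y_def coeff_pCons split: nat.splits if_splits)
  ultimately show "total_degree (var_x :: 'a poly poly) = 1" "total_degree (var_y :: 'a poly poly) = 1"
    by simp_all
qed

lemma var_nonzero [simp]: "var_x \<noteq> 0" "var_y \<noteq> 0"
  by (simp_all add: var_x_def var_y_def)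

lemma poly_bracket_vars [simp]:
  "poly_bracket var_x var_y = 1" "poly_bracket var_y var_x = - 1"
  by (simp_all add: poly_bracket_def poly_dx_def var_x_def var_y_def map_poly_pCons pderiv_pCons
      flip: one_pCons)

definition line :: "'k::field \<Rightarrow> 'k \<Rightarrow> 'k \<Rightarrow> 'k poly poly" where
  "line a b c = cst a * var_x + cst b * var_y + cst c"

text \<open>By bilinearity only {x, y} = 1 contributes. The constant is the determinant of the
  linear parts; it is nonzero exactly for transversal lines.\<close>

lemma poly_bracket_line: "poly_bracket (line a b c) (line a' b' c') = cst (a * b' - a' * b)"
  by (simp add: line_def poly_bracket_add_left poly_bracket_add_right poly_bracket_mult_left
      poly_bracket_mult_right cst_diff cst_mult algebra_simps)

lemma total_degree_line:
  assumes "line a b c \<notin> range cst"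
  shows "total_degree (line a b c) = 1"
proof (rule antisym)
  have m: "total_degree (cst d * p) \<le> total_degree p" for d :: 'a and p
    by (cases "d = 0"; cases "p = 0") (simp_all add: total_degree_mult)
  show "total_degree (line a b c) \<le> 1"
    using total_degree_add_le [of "cst a * var_x" "cst b * var_y"] m [of a var_x] m [of b var_y]
      total_degree_add_le [of "cst a * var_x + cst b * var_y" "cst c"]
    by (simp add: line_def)
  show "1 \<le> total_degree (line a b c)"
    using total_degree_0_imp_cst [of "line a b c"] assms by fastforce
qed

text \<open>Bracketing with \<open>r\<close> is a derivation that kills constants, so its kernel is
  a subalgebra.\<close>

lemma alg_generated_poly_bracket_eq_0:
  assumes "p \<in> alg_generated S" "\<And>q. q \<in> S \<Longrightarrow> poly_bracket r q = 0"
  shows "poly_bracket r p = 0"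
  using assms(1)
  by induction (simp_all add: assms(2) poly_bracket_add_right poly_bracket_mult_right)

text \<open>If the determinant vanishes, the first line commutes with both generators, hence with x
  and y. These two brackets are -b and a, so the line would be constant.\<close>

lemma alg_generated_lines_det:
  assumes "alg_generated {line a b c, line a' b' c'} = UNIV" "line a b c \<notin> range cst"
  shows "a * b' \<noteq> a' * b"
proof
  assume det: "a * b' = a' * b"
  have "poly_bracket (line a b c) q = 0" for q
  proof (rule alg_generated_poly_bracket_eq_0)
    show "q \<in> alg_generated {line a b c, line a' b' c'}" using assms(1) by simp
  qed (auto simp: poly_bracket_line det)
  from this [of var_x] this [of var_y] have "a = 0 \<and> b = 0"
    by (simp add: line_def poly_bracket_add_left poly_bracket_mult_left)
  then show False using assms(2) by (simp add: line_def)
qed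

section \<open>Homomorphisms of Poisson fields\<close>

lemma w_valuation_0: "w_valuation K w \<nu> \<Longrightarrow> \<nu> 0 = Pinf"
  by (simp add: w_valuation_def)

lemma poisson_hom_0: "poisson_hom K L \<phi> \<Longrightarrow> \<phi> 0 = 0"
proof -
  assume "poisson_hom K L \<phi>"
  then have "\<phi> (0 + 0) = \<phi> 0 + \<phi> 0"
    by (simp only: poisson_hom_def)
  then have "\<phi> 0 = \<phi> 0 + \<phi> 0"
    by (simp only: add_0_left)
  then show "\<phi> 0 = 0"
    by (rule iffD1 [OF add_cancel_right_right])
qed

lemma poisson_hom_eq_0_iff:
  assumes "poisson_hom K L \<phi>"
  shows "\<phi> a = 0 \<longleftrightarrow> a = 0"
proof -
  have "\<phi> a * \<phi> (inverse a) = \<phi> (a * inverse a)" "\<phi> 1 = 1"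
    using assms by (simp_all only: poisson_hom_def)
  then have "\<phi> a * \<phi> (inverse a) = 1" if "a \<noteq> 0"
    using that by simp
  then show ?thesis using poisson_hom_0 [OF assms] by force
qed

lemma poisson_hom_inj:
  assumes "poisson_hom K L \<phi>"
  shows "inj \<phi>"
proof (rule injI)
  fix a b
  assume eq: "\<phi> a = \<phi> b"
  have "\<phi> a = \<phi> ((a - b) + b)" by simp
  also have "\<dots> = \<phi> (a - b) + \<phi> b"
    using assms by (simp only: poisson_hom_def)
  finally show "a = b"
    using eq poisson_hom_eq_0_iff [OF assms, of "a - b"] by simp
qed

text \<open>Injectivity of \<phi> ensures that only 0 is sent to the value \<infinity>.\<close>

lemma w_valuation_poisson_hom:
  assumes "poisson_hom K L \<phi>" "w_valuation L w \<nu>"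
  shows "w_valuation K w (\<nu> \<circ> \<phi>)"
  using assms poisson_hom_eq_0_iff [OF assms(1)]
  by (simp add: w_valuation_def poisson_hom_def)

lemma poisson_hom_comp:
  "poisson_hom K L \<phi> \<Longrightarrow> poisson_hom L M \<psi> \<Longrightarrow> poisson_hom K M (\<psi> \<circ> \<phi>)"
  by (simp add: poisson_hom_def)

text \<open>Valuations of the target are pulled back. The pullback of a nontrivial valuation may be
  trivial, but then the value in question is 0 or \<infinity>.\<close>

lemma poisson_hom_Gamma0:
  assumes \<phi>: "poisson_hom K L \<phi>" and a: "a \<in> Gamma0 n K"
  shows "\<phi> a \<in> Gamma0 n L"
  unfolding Gamma0_def
proof clarify
  fix \<nu>
  assume \<nu>: "w_valuation L n \<nu>"
  note val = w_valuation_poisson_hom [OF \<phi> \<nu>]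
  show "0 \<le> \<nu> (\<phi> a)"
  proof (cases "trivial_valuation (\<nu> \<circ> \<phi>)")
    case True
    then show ?thesis
      using poisson_hom_0 [OF \<phi>] w_valuation_0 [OF \<nu>]
      by (cases "a = 0") (simp_all add: trivial_valuation_def)
  next
    case False
    then show ?thesis
      using a val by (auto simp: Gamma0_def)
  qed
qed

lemma poisson_iso_refl: "poisson_iso K K"
  unfolding poisson_iso_def by (rule exI [of _ id]) (simp add: poisson_hom_def bij_id)

section \<open>Products of lines\<close>

lemma proportionalE:
  fixes x y :: "'a::field"
  assumes nz: "x \<noteq> 0 \<or> y \<noteq> 0" "x' \<noteq> 0 \<or> y' \<noteq> 0" and det: "x * y' = x' * y"
  obtains u where "u \<noteq> 0" "x' = u * x" "y' = u * y"
proof (cases "x = 0")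
  case True
  with nz det that [of "y' / y"] show ?thesis by auto
next
  case False
  then have "x' = x' / x * x" "y' = x' / x * y"
    using det by (simp_all add: field_simps)
  with nz that [of "x' / x"] show ?thesis by fastforce
qed

text \<open>The common form of the two alternatives of the theorem: generation of the algebra is
  replaced by a nonzero determinant, which is what the bracket detects.\<close>

locale line_arrangement =
  fixes n :: nat and a b c :: "nat \<Rightarrow> 'k::field"
  assumes nonempty: "1 \<le> n"
    and nonconst: "i \<in> {1..n} \<Longrightarrow> line (a i) (b i) (c i) \<notin> range cst"
    and distinct: "i \<in> {1..n} \<Longrightarrow> j \<in> {1..n} \<Longrightarrow> i \<noteq> j \<Longrightarrow> u \<noteq> 0 \<Longrightarrow>
      line (a i) (b i) (c i) \<noteq> cst u * line (a j) (b j) (c j)"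
    and transversals: "i \<in> {1..n} \<Longrightarrow> 3 \<le> card {j \<in> {1..n}. a i * b j \<noteq> a j * b i}"
begin

abbreviation l :: "nat \<Rightarrow> 'k poly poly" where
  "l i \<equiv> line (a i) (b i) (c i)"

definition f :: "'k poly poly" where
  "f = (\<Prod>i=1..n. l i)"

lemma line_nonzero: "i \<in> {1..n} \<Longrightarrow> l i \<noteq> 0"
  using nonconst [of i] by (metis cst_0 rangeI)

lemma f_nonzero: "f \<noteq> 0"
  using line_nonzero by (auto simp: f_def)

lemma total_degree_f: "total_degree f = n"
proof -
  have "- int (total_degree f) = (\<Sum>i=1..n. - int (total_degree (l i)))"
    unfolding f_def by (rule degree_valuation.val_prod) (rule line_nonzero)
  also have "\<dots> = - int n"
    using total_degree_line [OF nonconst] by (simp add: sum_negf)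
  finally show ?thesis by simp
qed

text \<open>The linear parts are proportional; if \<open>d\<close> were 0, the two lines would be
  proportional as well.\<close>

lemma parallel_lines:
  assumes i: "i \<in> {1..n}" and j: "j \<in> {1..n}" and "i \<noteq> j" and det: "a i * b j = a j * b i"
  obtains u d where "d \<noteq> 0" "l j = cst u * l i + cst d"
proof -
  have nz: "a k \<noteq> 0 \<or> b k \<noteq> 0" if "k \<in> {1..n}" for k
    using nonconst [OF that] by (auto simp: line_def)
  obtain u where "u \<noteq> 0" and u: "a j = u * a i" "b j = u * b i"
    using nz [OF i] nz [OF j] det by (rule proportionalE)
  have lj: "l j = cst u * l i + cst (c j - u * c i)"
    by (simp add: line_def u cst_mult cst_diff algebra_simps)
  have "c j - u * c i \<noteq> 0"
    using distinct [OF j i _ \<open>u \<noteq> 0\<close>] lj \<open>i \<noteq> j\<close> by auto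
  then show thesis using lj that by blast
qed

text \<open>The bracket of the two lines is a nonzero constant times \<open>f\<close>, whose value
  is the sum over all lines; the values of the chosen two cancel.\<close>

lemma bracket_lines_bound:
  assumes "poly_valuation v"
    and bracket: "\<And>p q. p \<noteq> 0 \<Longrightarrow> q \<noteq> 0 \<Longrightarrow>
      poly_valuation.at_least v (v p + v q - w) (poly_bracket p q * f)"
    and i: "i \<in> {1..n}" and j: "j \<in> {1..n}" and det: "a i * b j \<noteq> a j * b i"
  shows "- w \<le> (\<Sum>k\<in>{1..n} - {i, j}. v (l k))"
proof -
  interpret poly_valuation v by fact
  have "v (l i) + v (l j) - w \<le> v f"
    using bracket [OF line_nonzero [OF i] line_nonzero [OF j]] det f_nonzero
    by (simp add: poly_bracket_line at_least_def val_cst_mult)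
  moreover have "v f = (\<Sum>k=1..n. v (l k))"
    unfolding f_def by (rule val_prod) (rule line_nonzero)
  moreover have "(\<Sum>k=1..n. v (l k)) = (\<Sum>k\<in>{1..n} - {i, j}. v (l k)) + (\<Sum>k\<in>{i, j}. v (l k))"
    using i j by (intro sum.subset_diff) auto
  moreover have "i \<noteq> j" using det by auto
  ultimately show ?thesis by simp
qed

lemma one_valuation_vars_nonneg:
  assumes "poly_valuation v"
    and bracket: "\<And>p q. p \<noteq> 0 \<Longrightarrow> q \<noteq> 0 \<Longrightarrow>
      poly_valuation.at_least v (v p + v q - 1) (poly_bracket p q * f)"
  shows "0 \<le> v var_x \<and> 0 \<le> v var_y"
proof (rule ccontr)
  interpret poly_valuation v by fact
  define d where "d = min (v var_x) (v var_y)"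
  assume "\<not> (0 \<le> v var_x \<and> 0 \<le> v var_y)"
  then have d: "d < 0" by (auto simp: d_def)
  \<comment> \<open>Applied with m = d and with m = d + 1, which is still at most 0 because
    \<open>d\<close> is a negative integer.\<close>
  have const: "at_least m (cst e)" if "m \<le> 0" for m e
    using at_least_cst [of e] that by (auto simp: at_least_def)
  have "at_least d (l k)" for k
    unfolding line_def using d
    by (intro at_least_add at_least_cst_mult const) (auto simp: at_least_def d_def)
  then have ge: "d \<le> v (l k)" if "k \<in> {1..n}" for k
    using line_nonzero [OF that] by (simp add: at_least_def)
  have transversal: "v (l i) = d \<or> v (l j) = d"
    if ij: "i \<in> {1..n}" "j \<in> {1..n}" and det: "a i * b j \<noteq> a j * b i" for i j
  proof (rule ccontr)
    assume "\<not> (v (l i) = d \<or> v (l j) = d)"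
    then have li: "at_least (d + 1) (l i)" and lj: "at_least (d + 1) (l j)"
      using ge [OF ij(1)] ge [OF ij(2)] by (auto simp: at_least_def)
    have D: "a i * b j - a j * b i \<noteq> 0" using det by simp
    \<comment> \<open>Cramer's rule: two transversal lines and the constants span x and y. If both
      lines had values above \<open>d\<close>, so would x and y.\<close>
    have x: "cst (a i * b j - a j * b i) * var_x =
        cst (b j) * l i + cst (- b i) * l j + cst (b i * c j - b j * c i)"
      and y: "cst (a i * b j - a j * b i) * var_y =
        cst (- a j) * l i + cst (a i) * l j + cst (a j * c i - a i * c j)"
      by (simp_all add: line_def cst_mult cst_diff cst_minus algebra_simps)
    have "at_least (d + 1) (cst (a i * b j - a j * b i) * var_x)"
      unfolding x using d li lj by (intro at_least_add at_least_cst_mult const) simp_all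
    moreover have "at_least (d + 1) (cst (a i * b j - a j * b i) * var_y)"
      unfolding y using d li lj by (intro at_least_add at_least_cst_mult const) simp_all
    ultimately have "d + 1 \<le> v var_x" "d + 1 \<le> v var_y"
      using D by (simp_all add: at_least_def val_cst_mult)
    then show False by (simp add: d_def)
  qed
  have "Max ((\<lambda>k. v (l k)) ` {1..n}) \<in> (\<lambda>k. v (l k)) ` {1..n}"
    using nonempty by (intro Max_in) auto
  then obtain i where i_max: "Max ((\<lambda>k. v (l k)) ` {1..n}) = v (l i)" and i: "i \<in> {1..n}"
    by (rule imageE)
  have max: "v (l k) \<le> v (l i)" if "k \<in> {1..n}" for k
    unfolding i_max [symmetric] using that by (intro Max_ge) auto
  define J where "J = {j \<in> {1..n}. a i * b j \<noteq> a j * b i}"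
  \<comment> \<open>If \<open>v (l j)\<close> exceeded \<open>d\<close>, so would
    \<open>v (l i)\<close> by maximality, contrary to \<open>transversal\<close>.\<close>
  have J: "v (l j) = d" if "j \<in> J" for j
    using transversal [OF i, of j] that ge [of j] max [of j] by (auto simp: J_def)
  have parallel: "v (l k) \<le> 0" if k: "k \<in> {1..n} - J" "k \<noteq> i" for k
  proof -
    have "k \<in> {1..n}" "i \<noteq> k" "a i * b k = a k * b i"
      using k by (auto simp: J_def)
    with i obtain u e where e: "e \<noteq> 0" and lk: "l k = cst u * l i + cst e"
      by (rule parallel_lines)
    \<comment> \<open>By maximality of \<open>v (l i)\<close>, both terms have at least the value of
      \<open>l k\<close>, while their sum is a nonzero constant, of value 0.\<close>
    have "at_least (v (l k)) (l k + cst (- u) * l i)"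
      using max [of k] k
      by (intro at_least_add at_least_cst_mult) (auto simp: at_least_def)
    moreover have "l k + cst (- u) * l i = cst e"
      by (simp add: lk cst_minus)
    ultimately show ?thesis
      using e by (simp add: at_least_def cst)
  qed
  have cardJ: "3 \<le> card J" using transversals [OF i] by (simp add: J_def)
  then have "J \<noteq> {}" by auto
  then obtain j where j: "j \<in> J" by blast
  have J': "J \<subseteq> {1..n}" "finite J" "i \<notin> J" by (auto simp: J_def)
  have "- 1 \<le> (\<Sum>k\<in>{1..n} - {i, j}. v (l k))"
    by (rule bracket_lines_bound) (use assms i j in \<open>auto simp: J_def\<close>)
  \<comment> \<open>The first sum runs over the other lines parallel to \<open>l i\<close>, the
    second over the remaining transversal ones.\<close>
  also have "\<dots> = (\<Sum>k\<in>{1..n} - {i, j} - (J - {j}). v (l k)) + (\<Sum>k\<in>J - {j}. v (l k))"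
    using J' by (intro sum.subset_diff) auto
  also have "\<dots> \<le> 0 + (\<Sum>k\<in>J - {j}. d)"
    by (intro add_mono sum_nonpos) (use J parallel j in auto)
  also have "\<dots> = int (card J - 1) * d"
    using j J' by simp
  \<comment> \<open>At least two transversal lines remain after removing \<open>j\<close>, and 2 d
    \<le> -2 contradicts the bound -1.\<close>
  also have "\<dots> \<le> 2 * d"
    using d cardJ by (intro mult_right_mono_neg) auto
  finally show False using d by simp
qed

lemma Gamma0_eq: "Gamma0 1 (Kxy (to_fract f)) = range to_fract"
proof (rule equalityI [OF Gamma0_subset_range_to_fract subsetI])
  fix q :: "'k poly poly fract"
  assume "q \<in> range to_fract"
  then obtain p where q: "q = to_fract p" by (rule imageE)
  show "q \<in> Gamma0 1 (Kxy (to_fract f))"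
    unfolding Gamma0_def
  proof clarify
    fix \<nu>
    assume \<nu>: "w_valuation (Kxy (to_fract f)) 1 \<nu>"
    interpret poly_valuation "val_int \<nu>" by (rule poly_valuation_val_int [OF \<nu>])
    have "0 \<le> val_int \<nu> var_x \<and> 0 \<le> val_int \<nu> var_y"
      using poly_valuation_axioms val_int_bracket [OF \<nu>] by (rule one_valuation_vars_nonneg)
    then have "at_least 0 var_x" "at_least 0 var_y"
      by (simp_all add: at_least_def)
    then have p: "at_least 0 p" by (rule at_least_0)
    show "0 \<le> \<nu> q"
    proof (cases "p = 0")
      case True
      then show ?thesis by (simp add: q w_valuation_0 [OF \<nu>])
    next
      case False
      then show ?thesis
        using p by (simp add: q val_int_Fin [OF \<nu>] at_least_def zero_extended_def)
    qed
  qed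
qed

section \<open>The heights of a line arrangement\<close>

lemma valuation_bound:
  assumes \<nu>: "w_valuation (Kxy (to_fract f)) w \<nu>"
    and F0: "F0 \<nu> \<inter> range to_fract \<subseteq> range (\<lambda>e. to_fract (cst e))"
  shows "int n - 2 \<le> w"
proof -
  have neg: "val_int \<nu> (l k) \<le> - 1" if k: "k \<in> {1..n}" for k
  proof (rule ccontr)
    assume "\<not> val_int \<nu> (l k) \<le> - 1"
    then have "to_fract (l k) \<in> F0 \<nu>"
      using val_int_Fin [OF \<nu> line_nonzero [OF k]] by (simp add: F0_def zero_extended_def)
    then show False
      using F0 nonconst [OF k] by force
  qed
  have 1: "1 \<in> {1..n}" using nonempty by simp
  have "{j \<in> {1..n}. a 1 * b j \<noteq> a j * b 1} \<noteq> {}"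
    using transversals [OF 1] by (metis card.empty not_numeral_le_zero)
  then obtain j where j: "j \<in> {1..n}" "a 1 * b j \<noteq> a j * b 1" by blast
  have "- w \<le> (\<Sum>k\<in>{1..n} - {1, j}. val_int \<nu> (l k))"
    using poly_valuation_val_int [OF \<nu>] val_int_bracket [OF \<nu>] 1 j by (rule bracket_lines_bound)
  also have "\<dots> \<le> (\<Sum>k\<in>{1..n} - {1, j}. - 1)"
    using neg by (intro sum_mono) auto
  also have "\<dots> = - int (card ({1..n} - {1, j}))"
    by simp
  also have "card ({1..n} - {1, j}) = n - 2"
    using 1 j by (subst card_Diff_subset) (auto simp: card_insert_if)
  finally show ?thesis by linarith
qed

lemma vht_eq: "vht 1 (Kxy (to_fract f)) = ereal (real n)"
proof -
  let ?K = "Kxy (to_fract f)"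
  let ?W = "{w. \<exists>\<nu>. w_valuation ?K w \<nu> \<and> \<not> classical ?K w \<nu> \<and>
    F0 \<nu> \<inter> Gamma0 1 ?K = range (scalar ?K)}"
  have scalars: "range (scalar ?K) = range (\<lambda>e. to_fract (cst e))"
    by (simp add: Kxy_def)
  have val: "w_valuation ?K (int n - 2) neg_degree"
    using w_valuation_neg_degree [of f] by (simp add: total_degree_f)
  \<comment> \<open>The pair x, y witnesses nonclassicality: both sides equal -n.\<close>
  have "\<not> neg_degree (to_fract var_x) + neg_degree (to_fract var_y) - Fin (int n - 2)
      < neg_degree (bracket ?K (to_fract var_x) (to_fract var_y))"
    using f_nonzero
    by (simp add: bracket_Kxy_vars degree_valuation.fract_val_to_fract total_degree_f)
  then have "\<not> classical ?K (int n - 2) neg_degree"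
    unfolding classical_def by (metis to_fract_eq_0_iff var_nonzero)
  moreover have "neg_degree (to_fract (cst e)) \<ge> 0" for e :: 'k
    by (cases "e = 0") (simp_all add: degree_valuation.fract_val_to_fract zero_extended_def)
  then have "F0 neg_degree \<inter> Gamma0 1 ?K = range (scalar ?K)"
    using F0_neg_degree unfolding Gamma0_eq scalars by (auto simp: F0_def)
  ultimately have "int n - 2 \<in> ?W" using val by blast
  then have "(INF w\<in>?W. ereal (real_of_int w)) \<le> ereal (real_of_int (int n - 2))"
    by (rule INF_lower)
  moreover have "ereal (real_of_int (int n - 2)) \<le> (INF w\<in>?W. ereal (real_of_int w))"
  proof (rule INF_greatest)
    fix w
    assume "w \<in> ?W"
    then have "int n - 2 \<le> w"
      using valuation_bound unfolding Gamma0_eq scalars by blast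
    then show "ereal (real_of_int (int n - 2)) \<le> ereal (real_of_int w)"
      by (simp only: ereal_less_eq of_int_le_iff)
  qed
  ultimately have "(INF w\<in>?W. ereal (real_of_int w)) = ereal (real n - 2)"
    by (simp add: antisym)
  then have "vht 1 ?K = ereal 2 + ereal (real n - 2)"
    by (simp only: vht_def numeral_eq_ereal)
  then show ?thesis by simp
qed

lemma poisson_hom_degree_bound:
  assumes \<phi>: "poisson_hom (Kxy (to_fract f)) (Kxy (to_fract h)) \<phi>"
  shows "n \<le> total_degree h"
proof -
  have poly: "\<phi> (to_fract p) \<in> range to_fract" for p
    using poisson_hom_Gamma0 [OF \<phi>, of "to_fract p" 1] Gamma0_subset_range_to_fract
    by (auto simp: Gamma0_eq)
  have scalar: "\<phi> (to_fract (cst e)) = to_fract (cst e)" for e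
    using \<phi> by (simp add: poisson_hom_def Kxy_def)
  have "int n - 2 \<le> int (total_degree h) - 2"
  proof (rule valuation_bound)
    show "w_valuation (Kxy (to_fract f)) (int (total_degree h) - 2) (neg_degree \<circ> \<phi>)"
      by (rule w_valuation_poisson_hom [OF \<phi> w_valuation_neg_degree])
    show "F0 (neg_degree \<circ> \<phi>) \<inter> range to_fract \<subseteq> range (\<lambda>e. to_fract (cst e))"
    proof clarify
      fix p :: "'k poly poly"
      assume "to_fract p \<in> F0 (neg_degree \<circ> \<phi>)"
      then have "\<phi> (to_fract p) \<in> F0 neg_degree \<inter> range to_fract"
        using poly by (simp add: F0_def)
      then obtain e where "\<phi> (to_fract p) = to_fract (cst e)"
        using F0_neg_degree by blast
      \<comment> \<open>A homomorphism fixes the scalars and is injective, so a constant image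
        forces a constant argument.\<close>
      then have "to_fract p = to_fract (cst e)"
        using injD [OF poisson_hom_inj [OF \<phi>]] scalar by metis
      then show "to_fract p \<in> range (\<lambda>e. to_fract (cst e))" by blast
    qed
  qed
  then show ?thesis by simp
qed

lemma fht_eq: "fht (Kxy (to_fract f)) = enat n"
proof (rule antisym)
  show "fht (Kxy (to_fract f)) \<le> enat n"
    unfolding fht_def using poisson_iso_refl by (intro INF_lower2 [of f]) (auto simp: total_degree_f)
  show "enat n \<le> fht (Kxy (to_fract f))"
    unfolding fht_def
    by (intro INF_greatest) (auto simp: poisson_iso_def intro: poisson_hom_degree_bound)
qed

text \<open>The target bracket may be given by a rational function. Composing the embedding with an
  isomorphism onto some K{h}, \<open>h\<close> a polynomial, gives a homomorphism to which the
  degree bound applies.\<close>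

lemma height_cohereditary: "height_cohereditary (Kxy (to_fract f))"
  unfolding height_cohereditary_def
proof clarify
  fix g :: "'k poly poly fract"
  assume "poisson_embeds (Kxy (to_fract f)) (Kxy g)"
  then obtain \<phi> where \<phi>: "poisson_hom (Kxy (to_fract f)) (Kxy g) \<phi>"
    by (auto simp: poisson_embeds_def)
  show "fht (Kxy (to_fract f)) \<le> fht (Kxy g)"
    unfolding fht_eq unfolding fht_def
    by (intro INF_greatest)
      (auto simp: poisson_iso_def intro: poisson_hom_degree_bound poisson_hom_comp [OF \<phi>])
qed

end

section \<open>Homogeneous products of lines\<close>

text \<open>The value at x = s, y = t; the outer variable y is substituted first.\<close>

definition eval2 :: "'k::field poly poly \<Rightarrow> 'k \<Rightarrow> 'k \<Rightarrow> 'k" where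
  "eval2 p s t = poly (poly p [:t:]) s"

lemma eval2_line: "eval2 (line a b c) s t = a * s + b * t + c"
  by (simp add: eval2_def line_def cst_def var_x_def var_y_def algebra_simps)

lemma eval2_prod: "eval2 (\<Prod>i\<in>A. g i) s t = (\<Prod>i\<in>A. eval2 (g i) s t)"
  by (simp add: eval2_def poly_prod)

lemma eval2_altdef:
  "eval2 p s t = (\<Sum>j\<le>degree p. \<Sum>i\<le>degree (coeff p j). coeff (coeff p j) i * s ^ i * t ^ j)"
proof -
  have "eval2 p s t = (\<Sum>j\<le>degree p. poly (coeff p j) s * t ^ j)"
    unfolding eval2_def poly_altdef [of p] by (simp add: poly_sum)
  then show ?thesis
    by (simp add: poly_altdef [of "coeff p j" for j] sum_distrib_right)
qed

lemma eval2_homogeneous: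
  assumes "homogeneous d p"
  shows "eval2 p (r * s) (r * t) = r ^ d * eval2 p s t"
  unfolding eval2_altdef sum_distrib_left
proof (intro sum.cong refl)
  fix i j
  show "coeff (coeff p j) i * (r * s) ^ i * (r * t) ^ j = r ^ d * (coeff (coeff p j) i * s ^ i * t ^ j)"
  proof (cases "coeff (coeff p j) i = 0")
    case False
    then have "d = i + j" using assms by (auto simp: homogeneous_def)
    then show ?thesis by (simp add: power_mult_distrib power_add)
  qed simp
qed

text \<open>The product of the factors is a nonzero polynomial with finitely many roots, and a field
  of characteristic zero is infinite.\<close>

lemma ex_nonzero_of_affine_factors:
  fixes \<alpha> \<beta> :: "'i \<Rightarrow> 'k::field_char_0"
  assumes "finite A" "\<And>i. i \<in> A \<Longrightarrow> \<alpha> i \<noteq> 0 \<or> \<beta> i \<noteq> 0"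
  obtains t where "\<And>i. i \<in> A \<Longrightarrow> \<alpha> i + \<beta> i * t \<noteq> 0"
proof -
  let ?p = "\<Prod>i\<in>A. [:\<alpha> i, \<beta> i:]"
  have "?p \<noteq> 0" using assms by auto
  then have "finite {t. poly ?p t = 0}" by (rule poly_roots_finite)
  then obtain t where "poly ?p t \<noteq> 0"
    using ex_new_if_finite [OF infinite_UNIV_char_0] by blast
  then show thesis
    using assms(1) that [of t] by (auto simp: poly_prod algebra_simps)
qed

text \<open>
  On a line through the origin that is parallel to no factor, a homogeneous product is a nonzero
  constant times a power of the parameter, so that no factor vanishes away from the origin.
\<close>

lemma homogeneous_prod_lines:
  fixes a b c :: "'i \<Rightarrow> 'k::field_char_0"
  assumes "finite A" and hom: "homogeneous d (\<Prod>i\<in>A. line (a i) (b i) (c i))"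
    and nz: "\<And>i. i \<in> A \<Longrightarrow> a i \<noteq> 0 \<or> b i \<noteq> 0" and i: "i \<in> A"
  shows "c i = 0"
proof (rule ccontr)
  assume "c i \<noteq> 0"
  let ?f = "\<Prod>i\<in>A. line (a i) (b i) (c i)"
  obtain s where s: "\<And>i. i \<in> A \<Longrightarrow> a i + b i * s \<noteq> 0"
    using ex_nonzero_of_affine_factors [OF assms(1), of a b] nz by blast
  have eval: "eval2 ?f t (t * s) = (\<Prod>i\<in>A. c i + (a i + b i * s) * t)" for t
    by (simp add: eval2_prod eval2_line algebra_simps)
  have scale: "eval2 ?f t (t * s) = t ^ d * eval2 ?f 1 s" for t
    using eval2_homogeneous [OF hom, of t 1 s] by simp
  \<comment> \<open>The parameter at which the line y = s x meets the factor \<open>i\<close>; it is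
    nonzero because this factor misses the origin.\<close>
  define r where "r = - c i / (a i + b i * s)"
  have "c i + (a i + b i * s) * r = 0"
    using s [OF i] by (simp add: r_def)
  then have "eval2 ?f r (r * s) = 0"
    unfolding eval using assms(1) i by (intro prod_zero) auto
  moreover have "r \<noteq> 0"
    using \<open>c i \<noteq> 0\<close> s [OF i] by (simp add: r_def)
  ultimately have "eval2 ?f 1 s = 0"
    unfolding scale by simp
  moreover obtain t where "\<And>i. i \<in> A \<Longrightarrow> c i + (a i + b i * s) * t \<noteq> 0"
    using ex_nonzero_of_affine_factors [OF assms(1), of c "\<lambda>i. a i + b i * s"] s by blast
  then have "eval2 ?f t (t * s) \<noteq> 0"
    unfolding eval using assms(1) by simp
  ultimately show False by (simp add: scale)
qed

theorem lemma6p2: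
  fixes f :: "'k::{alg_closed_field, field_char_0} poly poly"
    and n :: nat
    and a b c :: "nat \<Rightarrow> 'k"
    and l :: "nat \<Rightarrow> 'k poly poly"
  assumes n: "n \<ge> 1"
    and l: "\<And>i. i \<in> {1..n} \<Longrightarrow> l i = cst (a i) * var_x + cst (b i) * var_y + cst (c i)"
    and nonconst: "\<And>i. i \<in> {1..n} \<Longrightarrow> l i \<notin> range cst"
    and distinct: "\<And>i j. i \<in> {1..n} \<Longrightarrow> j \<in> {1..n} \<Longrightarrow> i \<noteq> j \<Longrightarrow>
                     \<not> (\<exists>u. u \<noteq> 0 \<and> l i = cst u * l j)"
    and f: "f = (\<Prod>i = 1..n. l i)"
    and hyp: "(\<forall>i \<in> {1..n}. card {j \<in> {1..n}. alg_generated {l i, l j} = UNIV} \<ge> 3) \<or>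
              (homogeneous n f \<and> n \<ge> 4)"
  shows "Gamma0 1 (Kxy (to_fract f)) = range to_fract \<and>
         flabby 1 f \<and>
         vht 1 (Kxy (to_fract f)) = ereal (real (total_degree f)) \<and>
         fht (Kxy (to_fract f)) = enat (total_degree f) \<and>
         height_cohereditary (Kxy (to_fract f))"
proof -
  have line: "l i = line (a i) (b i) (c i)" if "i \<in> {1..n}" for i
    using l [OF that] by (simp add: line_def)
  have nz: "a i \<noteq> 0 \<or> b i \<noteq> 0" if "i \<in> {1..n}" for i
    using nonconst [OF that] l [OF that] by auto
  have transversals: "3 \<le> card {j \<in> {1..n}. a i * b j \<noteq> a j * b i}" if i: "i \<in> {1..n}" for i
    using hyp
  proof
    assume *: "\<forall>i \<in> {1..n}. card {j \<in> {1..n}. alg_generated {l i, l j} = UNIV} \<ge> 3"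
    have "{j \<in> {1..n}. alg_generated {l i, l j} = UNIV} \<subseteq> {j \<in> {1..n}. a i * b j \<noteq> a j * b i}"
    proof safe
      fix j
      assume "j \<in> {1..n}" "alg_generated {l i, l j} = UNIV" "a i * b j = a j * b i"
      then show False
        using alg_generated_lines_det [of "a i" "b i" "c i" "a j" "b j" "c j"] nonconst [OF i]
        by (simp add: line [OF i] line)
    qed
    then have "card {j \<in> {1..n}. alg_generated {l i, l j} = UNIV} \<le>
        card {j \<in> {1..n}. a i * b j \<noteq> a j * b i}"
      by (intro card_mono) auto
    with * i show ?thesis by fastforce
  next
    assume *: "homogeneous n f \<and> n \<ge> 4"
    have c: "c j = 0" if "j \<in> {1..n}" for j
      by (rule homogeneous_prod_lines [of "{1..n}" n a b c]) (use * nz that in \<open>auto simp: f line\<close>)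
    have "a i * b j \<noteq> a j * b i" if j: "j \<in> {1..n}" "i \<noteq> j" for j
    proof
      assume det: "a i * b j = a j * b i"
      obtain u where "u \<noteq> 0" and u: "a j = u * a i" "b j = u * b i"
        using nz [OF i] nz [OF j(1)] det by (rule proportionalE)
      have "l j = cst u * l i"
        unfolding line [OF i] line [OF j(1)] line_def u c [OF i] c [OF j(1)]
        by (simp add: cst_mult algebra_simps)
      with \<open>u \<noteq> 0\<close> show False using distinct [OF j(1) i] j by auto
    qed
    \<comment> \<open>Distinct lines through the origin are transversal, and n - 1 \<ge> 3 others
      are available.\<close>
    then have "{1..n} - {i} \<subseteq> {j \<in> {1..n}. a i * b j \<noteq> a j * b i}" by auto
    then have "card ({1..n} - {i}) \<le> card {j \<in> {1..n}. a i * b j \<noteq> a j * b i}"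
      by (intro card_mono) auto
    moreover have "card ({1..n} - {i}) = n - 1"
      using i by simp
    ultimately show ?thesis using * by linarith
  qed
  interpret arr: line_arrangement n a b c
  proof
    fix i j u
    show "1 \<le> n" by (fact n)
    show "line (a i) (b i) (c i) \<notin> range cst" if "i \<in> {1..n}"
      using nonconst [OF that] line [OF that] by simp
    show "line (a i) (b i) (c i) \<noteq> cst u * line (a j) (b j) (c j)"
      if "i \<in> {1..n}" "j \<in> {1..n}" "i \<noteq> j" "u \<noteq> 0"
      using distinct [OF that(1-3)] that(4) unfolding line [OF that(1)] line [OF that(2)] by blast
    show "3 \<le> card {j \<in> {1..n}. a i * b j \<noteq> a j * b i}" if "i \<in> {1..n}"
      by (fact transversals [OF that])
  qed
  have f_eq: "f = arr.f"
    by (simp add: f arr.f_def line)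
  show ?thesis
    unfolding f_eq flabby_def arr.total_degree_f
    using arr.Gamma0_eq arr.vht_eq arr.fht_eq arr.height_cohereditary by simp
qed

end
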